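(* Let $n\ge 2$ be an integer and $n'=\frac{n}{n-1}$. Let $A$ be a Young function, with Young conjugate $\tilde A$, such that $$\int_0 \frac{\tilde A(t)}{t^{1+n'}}\,dt<\infty$$ (convergence of the integral near $0$) and such that its local upper Boyd index satisfies $I_A<n$. Let $A_n$ be the Young function defined by $$A_n(s)=\int_0^s r^{n'-1}\bigl(\Phi_n^{-1}(r^{n'})\bigr)^{n'}\,dr,\qquad s\ge 0,$$ where $\Phi_n^{-1}$ is the generalized left-continuous inverse of $\Phi_n(s)=\int_0^s \frac{\tilde A(t)}{t^{1+n'}}\,dt$. Let $\bar A_n$ be a Young function that is equivalent to $A_n$ near infinity, and let $\Omega$ be any open subset of $\mathbb{R}^n$. Assume that the continuous embedding $W^{1,A}(\Omega)\hookrightarrow L^{\bar A_n}(\Omega)$ holds, i.e. there is a constant $C>0$ such that $\|u\|_{L^{\bar A_n}(\Omega)}\le C\|u\|_{W^{1,A}(\Omega)}$ for all $u\in W^{1,A}(\Omega)$. Then $\Omega$ satisfies the measure density condition: there exists a constant $c>0$ such that for all $x\in\Omega$ and all $0<r\le 1$, $$|B(x,r)\cap\Omega|\ge c\,r^n.$$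
   Context: $|S|$ denotes the Lebesgue measure of $S\subset\mathbb{R}^n$, and $B(x,r)$ is the ball of center $x$ and radius $r$. Young function: a function $A:[0,\infty)\to[0,\infty]$ of the form $A(s)=\int_0^s a(r)\,dr$, where $a:[0,\infty)\to[0,\infty]$, $a(0)=0$, is increasing (non-decreasing), left-continuous, and neither identically zero nor identically infinite on $(0,\infty)$. Young conjugate: $\tilde A(s)=\sup\{sr-A(r): r>0\}$. Generalized left-continuous inverse of a non-decreasing function $F:[0,\infty)\to[0,\infty]$: $F^{-1}(r)=\inf\{s\ge 0: F(s)\ge r\}$. Equivalence near infinity: a Young function $B$ dominates a Young function $A$ near infinity if there are constants $c>0$ and $s_0>0$ with $A(s)\le B(cs)$ for all $s\ge s_0$; $A$ and $B$ are equivalent near infinity if each dominates the other near infinity. Local upper Boyd index: $I_A=\inf_{0<t<1}\frac{\log t}{\log h_A(t)}$, where $h_A(t)=\limsup_{s\to\infty}\frac{A^{-1}(st)}{A^{-1}(s)}$ for $t>0$, and here $A^{-1}(r)=\inf\{s\ge0: A(s)>r\}$ is the right-continuous inverse of $A$ (the quotient $\frac{\log t}{\log h_A(t)}$ is read as $+\infty$ if $h_A(t)=1$). Orlicz space: $L^A(\Omega)$ is the space of measurable $f$ on $\Omega$ with $\int_\Omega A(|f(x)|/\lambda)\,dx<\infty$ for some $\lambda>0$, with Luxemburg norm $\|f\|_{L^A(\Omega)}=\inf\{\lambda>0:\int_\Omega A(|f(x)|/\lambda)\,dx\le 1\}$. Orlicz–Sobolev space: $W^{m,A}(\Omega)$ is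 the space of $u\in L^A(\Omega)$ that are $m$-times weakly differentiable in $\Omega$ with $\nabla^\alpha u\in L^A(\Omega)$ for every multi-index $\alpha$ with $|\alpha|\le m$, with norm $\|u\|_{W^{m,A}(\Omega)}=\sum_{|\alpha|\le m}\|\nabla^\alpha u\|_{L^A(\Omega)}$; here $\nabla^\alpha u=\frac{\partial^{|\alpha|}u}{\partial x_1^{\alpha_1}\cdots\partial x_n^{\alpha_n}}$. *)

theory Defs
  imports "HOL-Analysis.Analysis"
begin

text \<open>
  Functions from \<open>[0,\<infinity>)\<close> to \<open>[0,\<infinity>]\<close> are represented as functions of type
  \<open>real \<Rightarrow> ennreal\<close>; their values at negative arguments are never used.
\<close>

definition young_function :: "(real \<Rightarrow> ennreal) \<Rightarrow> bool" where
  "young_function A \<longleftrightarrow>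
     (\<exists>a :: real \<Rightarrow> ennreal.
        a 0 = 0 \<and> mono_on {0..} a \<and>
        (\<forall>r>0. (a \<longlongrightarrow> a r) (at_left r)) \<and>
        (\<exists>r>0. a r \<noteq> 0) \<and> (\<exists>r>0. a r \<noteq> \<infinity>) \<and>
        (\<forall>s\<ge>0. A s = (\<integral>\<^sup>+r\<in>{0..s}. a r \<partial>lborel)))"

text \<open>
  Subtraction on \<open>ennreal\<close> is truncated at 0. This does not change the supremum:
  a Young function tends to 0 at 0, so the supremum of the untruncated differences is
  nonnegative.
\<close>

definition young_conjugate :: "(real \<Rightarrow> ennreal) \<Rightarrow> real \<Rightarrow> ennreal" where
  "young_conjugate A s = (SUP r\<in>{0<..}. ennreal (s * r) - A r)"

text \<open>In both inverses the infimum over the empty set is \<open>\<infinity>\<close>.\<close>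

definition left_inverse :: "(real \<Rightarrow> ennreal) \<Rightarrow> real \<Rightarrow> ennreal" where
  "left_inverse F r = (INF s\<in>{s. 0 \<le> s \<and> F s \<ge> ennreal r}. ennreal s)"

definition right_inverse :: "(real \<Rightarrow> ennreal) \<Rightarrow> real \<Rightarrow> ennreal" where
  "right_inverse F r = (INF s\<in>{s. 0 \<le> s \<and> F s > ennreal r}. ennreal s)"

definition dominates_near_infinity :: "(real \<Rightarrow> ennreal) \<Rightarrow> (real \<Rightarrow> ennreal) \<Rightarrow> bool" where
  "dominates_near_infinity B A \<longleftrightarrow> (\<exists>c>0. \<exists>s0>0. \<forall>s\<ge>s0. A s \<le> B (c * s))"

definition equivalent_near_infinity :: "(real \<Rightarrow> ennreal) \<Rightarrow> (real \<Rightarrow> ennreal) \<Rightarrow> bool" where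
  "equivalent_near_infinity A B \<longleftrightarrow>
     dominates_near_infinity A B \<and> dominates_near_infinity B A"

definition boyd_h :: "(real \<Rightarrow> ennreal) \<Rightarrow> real \<Rightarrow> ennreal" where
  "boyd_h A t = Limsup at_top (\<lambda>s. right_inverse A (s * t) / right_inverse A s)"

text \<open>
  For a Young function \<open>A\<close> and \<open>0 < t < 1\<close> one has \<open>t \<le> boyd_h A t \<le> 1\<close>, so
  \<open>enn2real\<close> loses nothing and the logarithm below is taken of a positive number.
\<close>

definition local_upper_boyd_index :: "(real \<Rightarrow> ennreal) \<Rightarrow> ereal" where
  "local_upper_boyd_index A =
     (INF t\<in>{0<..<1}. if boyd_h A t = 1 then \<infinity>
                       else ereal (ln t / ln (enn2real (boyd_h A t))))"


text \<open>Real powers on \<open>[0,\<infinity>]\<close>, for positive exponents only.\<close>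

definition ennreal_powr :: "ennreal \<Rightarrow> real \<Rightarrow> ennreal" where
  "ennreal_powr x p = (if x = \<infinity> then \<infinity> else ennreal (enn2real x powr p))"

definition dual_exponent :: "nat \<Rightarrow> real" where
  "dual_exponent n = real n / (real n - 1)"

definition Phi :: "nat \<Rightarrow> (real \<Rightarrow> ennreal) \<Rightarrow> real \<Rightarrow> ennreal" where
  "Phi n A s =
     (\<integral>\<^sup>+t\<in>{0<..s}. young_conjugate A t / ennreal (t powr (1 + dual_exponent n)) \<partial>lborel)"

definition sobolev_conjugate :: "nat \<Rightarrow> (real \<Rightarrow> ennreal) \<Rightarrow> real \<Rightarrow> ennreal" where
  "sobolev_conjugate n A s =
     (\<integral>\<^sup>+r\<in>{0<..s}. ennreal (r powr (dual_exponent n - 1)) *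
        ennreal_powr (left_inverse (Phi n A) (r powr dual_exponent n)) (dual_exponent n) \<partial>lborel)"


text \<open>
  Elements of function spaces are represented by functions on the whole of
  \<open>real^'n\<close>, of which only the values on \<open>\<Omega>\<close> matter; functions agreeing almost
  everywhere on \<open>\<Omega>\<close> are not identified. Norms take values in \<open>ennreal\<close>, and the
  Luxemburg norm is \<open>\<infinity>\<close> for measurable functions outside the space.
\<close>

definition orlicz_space ::
    "(real \<Rightarrow> ennreal) \<Rightarrow> (real^'n) set \<Rightarrow> (real^'n \<Rightarrow> real) set" where
  "orlicz_space A \<Omega> =
     {f \<in> borel_measurable (lebesgue_on \<Omega>).
        \<exists>\<mu>>0. (\<integral>\<^sup>+x. A (\<bar>f x\<bar> / \<mu>) \<partial>lebesgue_on \<Omega>) < \<infinity>}"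

definition orlicz_norm ::
    "(real \<Rightarrow> ennreal) \<Rightarrow> (real^'n) set \<Rightarrow> (real^'n \<Rightarrow> real) \<Rightarrow> ennreal" where
  "orlicz_norm A \<Omega> f =
     (INF \<mu>\<in>{\<mu>. 0 < \<mu> \<and> (\<integral>\<^sup>+x. A (\<bar>f x\<bar> / \<mu>) \<partial>lebesgue_on \<Omega>) \<le> 1}. ennreal \<mu>)"

definition partial_deriv :: "'n \<Rightarrow> (real^'n \<Rightarrow> real) \<Rightarrow> real^'n \<Rightarrow> real" where
  "partial_deriv i f x = frechet_derivative f (at x) (axis i 1)"

primrec C_k :: "nat \<Rightarrow> (real^'n \<Rightarrow> real) \<Rightarrow> bool" where
  "C_k 0 f \<longleftrightarrow> continuous_on UNIV f"
| "C_k (Suc k) f \<longleftrightarrow> (\<forall>x. f differentiable (at x)) \<and> (\<forall>i. C_k k (partial_deriv i f))"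

definition test_function :: "(real^'n) set \<Rightarrow> (real^'n \<Rightarrow> real) \<Rightarrow> bool" where
  "test_function \<Omega> \<phi> \<longleftrightarrow>
     (\<forall>k. C_k k \<phi>) \<and> compact (closure {x. \<phi> x \<noteq> 0}) \<and> closure {x. \<phi> x \<noteq> 0} \<subseteq> \<Omega>"

definition locally_integrable_on :: "(real^'n \<Rightarrow> real) \<Rightarrow> (real^'n) set \<Rightarrow> bool"
    (infix "locally'_integrable'_on" 46) where
  "f locally_integrable_on \<Omega> \<longleftrightarrow> (\<forall>K. compact K \<and> K \<subseteq> \<Omega> \<longrightarrow> set_integrable lebesgue K f)"

definition weak_partial_deriv ::
    "(real^'n) set \<Rightarrow> 'n \<Rightarrow> (real^'n \<Rightarrow> real) \<Rightarrow> (real^'n \<Rightarrow> real) \<Rightarrow> bool" where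
  "weak_partial_deriv \<Omega> i u v \<longleftrightarrow>
     u locally_integrable_on \<Omega> \<and> v locally_integrable_on \<Omega> \<and>
     (\<forall>\<phi>. test_function \<Omega> \<phi> \<longrightarrow>
        (LINT x:\<Omega>|lebesgue. u x * partial_deriv i \<phi> x) = - (LINT x:\<Omega>|lebesgue. v x * \<phi> x))"

definition orlicz_sobolev_space ::
    "(real \<Rightarrow> ennreal) \<Rightarrow> (real^'n) set \<Rightarrow> (real^'n \<Rightarrow> real) set" where
  "orlicz_sobolev_space A \<Omega> =
     {u \<in> orlicz_space A \<Omega>. \<forall>i. \<exists>v \<in> orlicz_space A \<Omega>. weak_partial_deriv \<Omega> i u v}"

text \<open>
  A weak derivative is unique only up to null sets. All its representatives have the same
  Luxemburg norm, so the infimum below is over a single value; it merely avoids choosing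
  a representative.
\<close>

definition orlicz_sobolev_norm ::
    "(real \<Rightarrow> ennreal) \<Rightarrow> (real^'n) set \<Rightarrow> (real^'n \<Rightarrow> real) \<Rightarrow> ennreal" where
  "orlicz_sobolev_norm A \<Omega> u =
     orlicz_norm A \<Omega> u +
     (\<Sum>i\<in>UNIV. INF v\<in>{v. weak_partial_deriv \<Omega> i u v}. orlicz_norm A \<Omega> v)"

end

theory Submission
  imports Defs
begin

text \<open>
  Write \<open>m(r)\<close> for the volume of \<open>B(x, r) \<inter> \<Omega>\<close>, and let \<open>s < r\<close> be the radius with
  \<open>m(s) = m(r) / 2\<close>. A cutoff function that is 1 on \<open>B(x, s)\<close>, vanishes off \<open>B(x, r)\<close> and has
  gradient of order \<open>1 / (r - s)\<close> can be inserted into the embedding, being continuously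
  differentiable. Its norm in the target space is about \<open>1 / A\<^sub>n\<^sup>-\<^sup>1(1 / m)\<close>, its Sobolev norm is at most about
  \<open>1 / ((r - s) A\<^sup>-\<^sup>1(1 / m))\<close>, where \<open>m = m(r)\<close>. Hence \<open>r - s\<close> is bounded by a multiple of
  \<open>A\<^sub>n\<^sup>-\<^sup>1(1 / m) / A\<^sup>-\<^sup>1(1 / m)\<close>, and this is at most a multiple of \<open>m powr (1 / n)\<close> as soon as
  \<open>A\<^sub>n\<^sup>-\<^sup>1(t) \<le> C t powr (- 1 / n) A\<^sup>-\<^sup>1(t)\<close> for large \<open>t\<close> (\<open>halving_radius_gap_le\<close>). Repeating the
  halving from \<open>r\<close> down to 0 and summing the gaps, whose bounds decay geometrically, gives
  \<open>r \<le> C' m(r) powr (1 / n)\<close> (\<open>radius_le_of_halving_gaps\<close>), which is the measure density condition.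

  The inequality between the inverses is where the index \<open>I\<^sub>A < n\<close> is used
  (\<open>sobolev_conjugate_inverse_bound\<close>). It says that \<open>g(t) = t powr (- 1 / n) A\<^sup>-\<^sup>1(t)\<close> grows at least
  geometrically along the points \<open>K ^ j\<close> with \<open>j\<close> large, for some \<open>K > 1\<close>. Let \<open>y(t) = t / A\<^sup>-\<^sup>1(t)\<close> be the slope of the
  secant of \<open>A\<close> at the height \<open>t\<close>; the Young conjugate of \<open>A\<close> is at most \<open>t\<close> there, so \<open>\<Phi>\<^sub>n\<close>
  increases by at most a multiple of \<open>g(t) powr n'\<close> between \<open>y(t)\<close> and \<open>y(K t)\<close>. Summing a geometric
  series, \<open>\<Phi>\<^sub>n(y(t)) \<le> M g(t) powr n'\<close>. Hence \<open>\<Phi>\<^sub>n\<^sup>-\<^sup>1(r powr n') \<ge> y(t)\<close> when \<open>r\<close> exceeds a multiple of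
  \<open>g(t)\<close>, and integrating over such \<open>r\<close> shows that \<open>A\<^sub>n\<close> at a multiple of \<open>g(t)\<close> is at least
  \<open>(g(t) y(t)) powr n' = t\<close>.
\<close>

section \<open>Young functions, their inverses and conjugates\<close>

lemma borel_measurable_mono_ennreal:
  fixes f :: "real \<Rightarrow> ennreal"
  assumes "mono f"
  shows "f \<in> borel_measurable borel"
proof (rule borel_measurableI_greater)
  fix c
  have "is_interval {x. c < f x}"
    unfolding is_interval_1 using monoD[OF assms] by (auto intro: less_le_trans)
  hence "{x. c < f x} \<in> sets borel" 
    by (rule real_interval_borel_measurable)
  thus "{x \<in> space borel. c < f x} \<in> sets borel" by simp
qed

text \<open>The density is continued by its value at 0 to negative arguments, which makes it
  monotone on the whole line and hence measurable.\<close>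

lemma young_function_densityE:
  assumes "young_function A"
  obtains a where "mono a" "\<exists>r>0. a r \<noteq> 0" "\<exists>r>0. a r \<noteq> \<infinity>"
    "\<And>s. 0 \<le> s \<Longrightarrow> A s = (\<integral>\<^sup>+r\<in>{0..s}. a r \<partial>lborel)"
proof -
  obtain a where a: "mono_on {0..} a" "\<exists>r>0. a r \<noteq> 0" "\<exists>r>0. a r \<noteq> \<infinity>"
    "\<forall>s\<ge>0. A s = (\<integral>\<^sup>+r\<in>{0..s}. a r \<partial>lborel)"
    using assms unfolding young_function_def by blast
  define a' where "a' r = a (max 0 r)" for r
  show thesis
  proof
    show "mono a'" using a(1) unfolding a'_def mono_def mono_on_def by auto
    have "a' r = a r" if "r > 0" for r using that by (simp add: a'_def max_def)
    thus "\<exists>r>0. a' r \<noteq> 0" "\<exists>r>0. a' r \<noteq> \<infinity>" using a(2,3) by auto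
    show "A s = (\<integral>\<^sup>+r\<in>{0..s}. a' r \<partial>lborel)" if "0 \<le> s" for s
      using a(4) that by (auto simp: a'_def indicator_def intro!: nn_integral_cong)
  qed
qed

lemma young_function_zero [simp]: "young_function A \<Longrightarrow> A 0 = 0"
  by (erule young_function_densityE) (simp add: nn_integral_null_set)

lemma young_function_mono:
  assumes "young_function A" "0 \<le> x" "x \<le> y"
  shows "A x \<le> A y"
proof -
  obtain a where a: "mono a" "\<exists>r>0. a r \<noteq> 0" "\<exists>r>0. a r \<noteq> \<infinity>"
    and A_eq: "\<And>s. 0 \<le> s \<Longrightarrow> A s = (\<integral>\<^sup>+r\<in>{0..s}. a r \<partial>lborel)"
    by (rule young_function_densityE[OF assms(1)]) blast
  thus ?thesis using assms by (auto simp: A_eq indicator_def intro!: nn_integral_mono)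
qed

lemma nn_integral_const_interval:
  "0 \<le> l \<Longrightarrow> (\<integral>\<^sup>+r. c * indicator {x<..x+l::real} r \<partial>lborel) = c * ennreal l"
  by (subst nn_integral_cmult_indicator) auto

text \<open>Since the density increases, the graph of \<open>A\<close> lies above each of its secants
  through the origin once these have been left behind: \<open>A x \<le> x * a x\<close>, whereas the
  increment of \<open>A\<close> from \<open>x\<close> to \<open>y\<close> is at least \<open>(y - x) * a x\<close>.\<close>

lemma young_function_superlinear:
  assumes A: "young_function A" and "0 < x" "1 \<le> k"
  shows "ennreal k * A x \<le> A (k * x)"
proof -
  obtain a where a: "mono a" "\<exists>r>0. a r \<noteq> 0" "\<exists>r>0. a r \<noteq> \<infinity>"
    and A_eq: "\<And>s. 0 \<le> s \<Longrightarrow> A s = (\<integral>\<^sup>+r\<in>{0..s}. a r \<partial>lborel)"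
    by (rule young_function_densityE[OF A]) blast
  have [measurable]: "a \<in> borel_measurable borel"
    using a(1) by (rule borel_measurable_mono_ennreal)
  define l where "l = (k - 1) * x"
  have l: "0 \<le> l" "k * x = x + l" using assms by (auto simp: l_def algebra_simps)
  have "A x \<le> (\<integral>\<^sup>+r. a x * indicator {0..x} r \<partial>lborel)"
    using assms monoD[OF a(1)] by (auto simp: A_eq indicator_def intro!: nn_integral_mono)
  also have "\<dots> = a x * ennreal x"
    using assms by (subst nn_integral_cmult_indicator) auto
  finally have "ennreal (k - 1) * A x \<le> ennreal (k - 1) * (a x * ennreal x)"
    by (intro mult_left_mono) auto
  also have "\<dots> = a x * ennreal l"
    using assms by (simp add: l_def ennreal_mult mult_ac)
  also have "\<dots> = (\<integral>\<^sup>+r. a x * indicator {x<..x+l} r \<partial>lborel)"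
    using l by (subst nn_integral_const_interval) auto
  finally have 1: "ennreal (k - 1) * A x \<le> (\<integral>\<^sup>+r. a x * indicator {x<..x+l} r \<partial>lborel)" .
  have Ax: "A x = (\<integral>\<^sup>+r. a r * indicator {0..x} r \<partial>lborel)"
    using assms by (simp add: A_eq)
  have "ennreal k * A x = A x + ennreal (k - 1) * A x"
    using assms by (metis distrib_right mult_1 ennreal_plus add.commute diff_add_cancel
        diff_ge_0_iff_ge zero_le_one ennreal_1)
  also have "\<dots> \<le> A x + (\<integral>\<^sup>+r. a x * indicator {x<..x+l} r \<partial>lborel)"
    by (intro add_left_mono 1)
  also have "\<dots> =
      (\<integral>\<^sup>+r. a r * indicator {0..x} r + a x * indicator {x<..x+l} r \<partial>lborel)"
    unfolding Ax by (rule nn_integral_add[symmetric]) auto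
  also have "\<dots> \<le> (\<integral>\<^sup>+r. a r * indicator {0..x + l} r \<partial>lborel)"
    using assms l monoD[OF a(1)] by (auto simp: indicator_def intro!: nn_integral_mono)
  also have "\<dots> = A (k * x)" using assms l by (simp add: A_eq)
  finally show ?thesis .
qed

lemma young_function_small_near_zero:
  assumes A: "young_function A" and "0 < e"
  shows "\<exists>x>0. A x \<le> ennreal e"
proof -
  obtain a where a: "mono a" "\<exists>r>0. a r \<noteq> 0" "\<exists>r>0. a r \<noteq> \<infinity>"
    and A_eq: "\<And>s. 0 \<le> s \<Longrightarrow> A s = (\<integral>\<^sup>+r\<in>{0..s}. a r \<partial>lborel)"
    by (rule young_function_densityE[OF A]) blast
  obtain r where r: "r > 0" "a r \<noteq> \<infinity>" using a(3) by blast
  then obtain c where c: "a r = ennreal c" "0 \<le> c" by (cases "a r") auto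
  define x where "x = min r (e / (c + 1))"
  have "0 < e / (c + 1)" "e / (c + 1) * (c + 1) = e" using c \<open>0 < e\<close> by auto
  moreover have "x * (c + 1) \<le> e / (c + 1) * (c + 1)"
    using c by (intro mult_right_mono) (auto simp: x_def)
  ultimately have x: "0 < x" "x \<le> r" "x * (c + 1) \<le> e" 
    using r by (auto simp: x_def)
  have "A x \<le> (\<integral>\<^sup>+t. ennreal c * indicator {0..x} t \<partial>lborel)"
    using x monoD[OF a(1), of _ r] c by (auto simp: A_eq indicator_def intro!: nn_integral_mono)
  also have "\<dots> = ennreal (c * x)"
    using x c by (subst nn_integral_cmult_indicator) (auto simp: ennreal_mult)
  also have "\<dots> \<le> ennreal e" using x by (intro ennreal_leI) (simp add: algebra_simps)
  finally show ?thesis using x by blast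
qed

lemma young_function_unbounded:
  assumes A: "young_function A"
  shows "\<exists>x>0. A x > ennreal t"
proof -
  obtain a where a: "mono a" "\<exists>r>0. a r \<noteq> 0" "\<exists>r>0. a r \<noteq> \<infinity>"
    and A_eq: "\<And>s. 0 \<le> s \<Longrightarrow> A s = (\<integral>\<^sup>+r\<in>{0..s}. a r \<partial>lborel)"
    by (rule young_function_densityE[OF A]) blast
  obtain r where r: "r > 0" "a r \<noteq> 0" using a(2) by blast
  obtain c where c: "ennreal c \<le> a r" "0 < c" 
  proof (cases "a r")
    case (real d) thus ?thesis using r that[of d] by auto
  next
    case top thus ?thesis using that[of 1] by auto
  qed
  define l where "l = (\<bar>t\<bar> + 1) / c"
  have l: "0 < l" "c * l = \<bar>t\<bar> + 1" using c by (auto simp: l_def)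
  have "ennreal t < ennreal (c * l)" using l by (intro ennreal_lessI) auto
  also have "\<dots> = ennreal c * ennreal l" using l c by (intro ennreal_mult) auto
  also have "\<dots> = (\<integral>\<^sup>+t. ennreal c * indicator {r<..r+l} t \<partial>lborel)"
    using l by (intro nn_integral_const_interval[symmetric]) auto
  also have "\<dots> \<le> A (r + l)"
    using r l order_trans[OF c(1) monoD[OF a(1), of r]]
    by (auto simp: A_eq indicator_def intro!: nn_integral_mono)
  finally show ?thesis using r l by (intro exI[of _ "r + l"]) auto
qed

text \<open>No information is lost in passing to real values: a Young function is unbounded, so its
  right-continuous inverse is finite.\<close>

definition real_inverse :: "(real \<Rightarrow> ennreal) \<Rightarrow> real \<Rightarrow> real" where
  "real_inverse A t = enn2real (right_inverse A t)"

lemma real_inverse_nonneg [simp]: "0 \<le> real_inverse A t" by (simp add: real_inverse_def)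

lemma right_inverse_eq_real_inverse:
  assumes "young_function A"
  shows "right_inverse A t = ennreal (real_inverse A t)"
proof -
  obtain x where "x > 0" "A x > ennreal t" using young_function_unbounded[OF assms] by blast
  hence "right_inverse A t \<le> ennreal x" unfolding right_inverse_def by (intro INF_lower) auto
  thus ?thesis unfolding real_inverse_def by (metis ennreal_enn2real ennreal_less_top le_less_trans)
qed

lemma real_inverse_above:
  assumes "young_function A" "real_inverse A t < x"
  shows "ennreal t < A x"
proof -
  have "right_inverse A t < ennreal x"
    using assms by (simp add: right_inverse_eq_real_inverse ennreal_less_iff)
  then obtain s where "0 \<le> s" "ennreal t < A s" "ennreal s < ennreal x"
    unfolding right_inverse_def by (auto simp: INF_less_iff)
  thus ?thesis using young_function_mono[OF assms(1), of s x] by (auto simp: ennreal_less_iff)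
qed

lemma real_inverse_below:
  assumes "young_function A" "0 \<le> x" "x < real_inverse A t"
  shows "A x \<le> ennreal t"
proof (rule ccontr)
  assume "\<not> A x \<le> ennreal t"
  hence "right_inverse A t \<le> ennreal x" unfolding right_inverse_def using assms
    by (intro INF_lower) auto
  thus False using assms by (simp add: right_inverse_eq_real_inverse)
qed

lemma real_inverse_pos:
  assumes "young_function A" "0 < t"
  shows "0 < real_inverse A t"
proof -
  obtain x where x: "x > 0" "A x \<le> ennreal t" using young_function_small_near_zero[OF assms] by blast
  show ?thesis using real_inverse_above[OF assms(1), of t x] x by force
qed

lemma real_inverse_mono:
  assumes "young_function A" "s \<le> t"
  shows "real_inverse A s \<le> real_inverse A t"
proof (rule ccontr)
  assume "\<not> ?thesis"
  then obtain x where "real_inverse A t < x" "x < real_inverse A s"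
    using dense[of "real_inverse A t" "real_inverse A s"] by (auto simp: not_le)
  moreover have "0 \<le> x" using \<open>real_inverse A t < x\<close> real_inverse_nonneg[of A t] by linarith
  ultimately have "ennreal t < A x" "A x \<le> ennreal s"
    using real_inverse_above[OF assms(1)] real_inverse_below[OF assms(1)] by blast+
  thus False using ennreal_leI[OF assms(2)] by (meson leD order_trans)
qed

lemma real_inverse_sublinear:
  assumes A: "young_function A" and "0 < t" "1 \<le> k"
  shows "real_inverse A (k * t) \<le> k * real_inverse A t"
proof (rule ccontr)
  assume "\<not> ?thesis"
  then obtain x where x: "k * real_inverse A t < x" "x < real_inverse A (k * t)"
    using dense[of "k * real_inverse A t" "real_inverse A (k * t)"] by (auto simp: not_le)
  have x0: "0 < x / k" using x real_inverse_pos[OF A \<open>0 < t\<close>] assms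
    by (smt (verit) divide_pos_pos mult_pos_pos)
  have 1: "A x \<le> ennreal (k * t)" using x x0 assms
    by (intro real_inverse_below) (auto simp: zero_less_divide_iff)
  have "real_inverse A t < x / k" using x assms by (simp add: field_simps)
  hence "ennreal t < A (x / k)" by (rule real_inverse_above[OF A])
  hence "ennreal k * ennreal t < ennreal k * A (x / k)"
    using assms by (intro ennreal_mult_strict_left_mono) auto
  also have "\<dots> \<le> A (k * (x / k))" by (rule young_function_superlinear[OF A x0 assms(3)])
  finally show False using 1 assms by (simp add: ennreal_mult leD)
qed

text \<open>At the slope \<open>t / A\<^sup>-\<^sup>1(t)\<close> of the secant, the supremum defining the conjugate cannot
  exceed \<open>t\<close>: to the left of \<open>A\<^sup>-\<^sup>1(t)\<close> already the linear term is at most \<open>t\<close>, and to the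
  right of it \<open>A\<close> is above that secant.\<close>

lemma young_conjugate_secant_le:
  assumes A: "young_function A" and t: "0 < t"
  shows "young_conjugate A (t / real_inverse A t) \<le> ennreal t"
  unfolding young_conjugate_def
proof (rule SUP_least)
  fix r :: real assume "r \<in> {0<..}"
  hence r: "0 < r" by simp
  define b where "b = real_inverse A t"
  have b: "0 < b" using real_inverse_pos[OF A t] by (simp add: b_def)
  show "ennreal (t / real_inverse A t * r) - A r \<le> ennreal t"
  proof (cases "r \<le> b")
    case True
    have "ennreal (t / b * r) - A r \<le> ennreal (t / b * r)" by simp
    also have "\<dots> \<le> ennreal t"
      using True t b by (intro ennreal_leI) (simp add: field_simps)
    finally show ?thesis by (simp add: b_def)
  next
    case False
    have secant: "ennreal (r / x * t) \<le> A r" if "b < x" "x < r" for x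
    proof -
      have "ennreal (r / x * t) = ennreal (r / x) * ennreal t"
        using that b r t by (intro ennreal_mult) auto
      also have "\<dots> \<le> ennreal (r / x) * A x"
        using that real_inverse_above[OF A, of t x] b_def by (intro mult_left_mono) auto
      also have "\<dots> \<le> A (r / x * x)"
        using that b by (intro young_function_superlinear[OF A]) auto
      finally show ?thesis using that b by simp
    qed
    have "((\<lambda>x. ennreal (r / x * t)) \<longlongrightarrow> ennreal (r / b * t)) (at_right b)"
      using b by (intro tendsto_ennrealI tendsto_intros) auto
    moreover have "eventually (\<lambda>x. ennreal (r / x * t) \<le> A r) (at_right b)"
      using False by (intro eventually_at_rightI[of b r] secant) auto
    ultimately have "ennreal (r / b * t) \<le> A r"
      by (intro tendsto_upperbound) auto
    hence "ennreal (t / b * r) - A r = 0" by (simp add: mult.commute diff_eq_0_iff_ennreal)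
    thus ?thesis by (simp add: b_def)
  qed
qed

lemma young_conjugate_mono: "mono (young_conjugate A)"
  unfolding young_conjugate_def
  by (intro monoI SUP_subset_mono order_refl ennreal_minus_mono ennreal_leI mult_right_mono) auto


section \<open>Growth of the Sobolev conjugate\<close>

text \<open>These bounds keep the quotient of logarithms in the definition of the index away from
  \<open>ln 0\<close> and from positive denominators. The lower one is the concavity of \<open>A\<^sup>-\<^sup>1\<close>.\<close>

lemma boyd_h_bounds:
  assumes A: "young_function A" and t: "0 < t" "t < 1"
  shows "ennreal t \<le> boyd_h A t" "boyd_h A t \<le> 1"
proof -
  have ratio: "right_inverse A (s * t) / right_inverse A s = 
      ennreal (real_inverse A (s * t) / real_inverse A s)" if "0 < s" for s
    using real_inverse_pos[OF A that] by (simp add: right_inverse_eq_real_inverse[OF A] divide_ennreal)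
  have "t \<le> real_inverse A (s * t) / real_inverse A s" if "0 < s" for s
    using real_inverse_sublinear[OF A, of "s * t" "1 / t"] real_inverse_pos[OF A that] t that
    by (simp add: field_simps)
  moreover have "real_inverse A (s * t) / real_inverse A s \<le> 1" if "0 < s" for s
    using real_inverse_mono[OF A, of "s * t" s] real_inverse_pos[OF A that] t that by simp
  ultimately have "\<forall>\<^sub>F s in at_top. ennreal t \<le> right_inverse A (s * t) / right_inverse A s"
    "\<forall>\<^sub>F s in at_top. right_inverse A (s * t) / right_inverse A s \<le> 1"
    by (auto intro!: eventually_mono[OF eventually_gt_at_top[of 0]] ennreal_leI 
        simp: ratio simp flip: ennreal_1)
  thus "ennreal t \<le> boyd_h A t" "boyd_h A t \<le> 1"
    unfolding boyd_h_def by (auto intro!: le_Limsup Limsup_bounded)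
qed

text \<open>An index below \<open>p\<close> provides some \<open>\<tau> < 1\<close> with \<open>boyd_h A \<tau> < \<tau> powr (1 / p)\<close>. Since the upper
  limit is strictly below this bound, there is room for a factor \<open>q > 1\<close> when passing from \<open>t\<close>
  to \<open>K * t\<close> with \<open>K = 1 / \<tau>\<close>: the function \<open>t powr (- 1 / p) * A\<^sup>-\<^sup>1(t)\<close> grows
  geometrically along such steps.\<close>

lemma boyd_index_imp_inverse_growth:
  assumes A: "young_function A" and p: "0 < p" and index: "local_upper_boyd_index A < ereal p"
  obtains K q t1 where "1 < K" "1 < q" "0 < t1"
    "\<And>t. t1 \<le> t \<Longrightarrow> q * K powr (1 / p) * real_inverse A t \<le> real_inverse A (K * t)"
proof -
  obtain \<tau> where \<tau>: "0 < \<tau>" "\<tau> < 1" 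
    and lt: "(if boyd_h A \<tau> = 1 then \<infinity> else ereal (ln \<tau> / ln (enn2real (boyd_h A \<tau>)))) < ereal p"
    using index unfolding local_upper_boyd_index_def INF_less_iff by fastforce
  define h where "h = enn2real (boyd_h A \<tau>)"
  have h_eq: "boyd_h A \<tau> = ennreal h"
    using boyd_h_bounds(2)[OF A \<tau>] unfolding h_def
    by (metis ennreal_enn2real ennreal_one_less_top le_less_trans)
  have "boyd_h A \<tau> \<noteq> 1" and ratio: "ln \<tau> / ln h < p"
    using lt by (auto simp: h_def split: if_splits)
  moreover have "\<tau> \<le> h" "h \<le> 1"
    using boyd_h_bounds[OF A \<tau>] \<tau> unfolding h_eq by (auto simp: ennreal_le_iff2)
  ultimately have h: "0 < h" "h < 1" using \<tau> h_eq by (cases "h = 1"; auto)+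
  hence "p * ln h < ln \<tau>" using ratio by (simp add: neg_divide_less_eq)
  hence "ln h < 1 / p * ln \<tau>" using p by (simp add: field_simps)
  hence "ln h < ln (\<tau> powr (1 / p))" using \<tau> by (simp add: ln_powr)
  hence "h < \<tau> powr (1 / p)"
    by (subst (asm) ln_less_cancel_iff) (use \<tau> h in auto)
  \<comment> \<open>The gap between \<open>\<theta>\<close> and \<open>\<tau> powr (1 / p)\<close> is what makes \<open>q\<close> exceed 1.\<close>
  then obtain \<theta> where \<theta>: "h < \<theta>" "\<theta> < \<tau> powr (1 / p)" using dense by blast
  have "boyd_h A \<tau> < ennreal \<theta>" using \<theta> h by (simp add: h_eq ennreal_less_iff)
  hence "\<forall>\<^sub>F s in at_top. right_inverse A (s * \<tau>) / right_inverse A s < ennreal \<theta>"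
    unfolding boyd_h_def by (rule Limsup_lessD)
  then obtain s1 where s1: "\<And>s. s1 \<le> s \<Longrightarrow> right_inverse A (s * \<tau>) / right_inverse A s < ennreal \<theta>"
    by (auto simp: eventually_at_top_linorder)
  show thesis
  proof
    show "1 < 1 / \<tau>" using \<tau> by simp
    show "1 < \<tau> powr (1 / p) / \<theta>" using \<theta> h by simp
    show "0 < max 1 s1" by simp
    fix t assume t: "max 1 s1 \<le> t"
    define s where "s = 1 / \<tau> * t"
    have "1 * t \<le> s" unfolding s_def using t \<tau> by (intro mult_right_mono) auto
    hence s: "0 < s" "s1 \<le> s" "s * \<tau> = t" using t \<tau> by (auto simp: s_def)
    have "real_inverse A t / real_inverse A s < \<theta>"
      using s1[OF s(2)] real_inverse_pos[OF A s(1)] s(3)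
      by (simp add: right_inverse_eq_real_inverse[OF A] divide_ennreal ennreal_less_iff)
    hence "real_inverse A t / \<theta> \<le> real_inverse A s"
      using real_inverse_pos[OF A s(1)] \<theta> h by (simp add: pos_divide_less_eq pos_divide_le_eq mult.commute)
    moreover have "\<tau> powr (1 / p) / \<theta> * (1 / \<tau>) powr (1 / p) * real_inverse A t = real_inverse A t / \<theta>"
      using \<tau> by (simp add: powr_divide)
    ultimately show "\<tau> powr (1 / p) / \<theta> * (1 / \<tau>) powr (1 / p) * real_inverse A t \<le> real_inverse A (1 / \<tau> * t)"
      unfolding s_def by metis
  qed
qed

text \<open>Growth conditions like the preceding one compare arguments in a fixed ratio only; every
  argument is reached by such steps from an initial interval.\<close>

lemma multiplicative_induct:
  fixes t :: real
  assumes "1 < K" "0 < t1"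
    and base: "\<And>t. t1 \<le> t \<Longrightarrow> t \<le> K * t1 \<Longrightarrow> P t"
    and step: "\<And>t. t1 \<le> t \<Longrightarrow> P t \<Longrightarrow> P (K * t)"
    and "t1 \<le> t"
  shows "P t"
proof -
  have "P t" if "t1 \<le> t" "t \<le> K ^ Suc j * t1" for j t
    using that
  proof (induction j arbitrary: t)
    case 0 thus ?case using base by simp
  next
    case (Suc j)
    show ?case
    proof (cases "t \<le> K * t1")
      case True thus ?thesis using base Suc by simp
    next
      case False
      hence "t1 \<le> t / K" "t / K \<le> K ^ Suc j * t1" using Suc.prems \<open>1 < K\<close>
        by (simp_all add: field_simps)
      hence "P (K * (t / K))" by (intro step Suc.IH)
      thus ?thesis using \<open>1 < K\<close> by simp
    qed
  qed
  moreover obtain j where "t / t1 < K ^ j" using real_arch_pow[OF \<open>1 < K\<close>] by blast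
  ultimately show ?thesis
    using assms(1,2) \<open>t1 \<le> t\<close> power_increasing[of j "Suc j" K]
    by (meson less_imp_le mult_right_mono order_trans pos_divide_less_eq lessI)
qed

lemma Phi_mono: "p \<le> q \<Longrightarrow> Phi n A p \<le> Phi n A q"
  unfolding Phi_def by (intro nn_integral_mono) (auto simp: indicator_def)

text \<open>On \<open>[p, q]\<close> the integrand is at most its numerator at \<open>q\<close> over its denominator at \<open>p\<close>.
  The estimate serves for points with bounded quotient \<open>q / p\<close>.\<close>

lemma Phi_increment_le:
  assumes "0 < p" "p \<le> q" and conj: "young_conjugate A q \<le> ennreal t" and "0 \<le> t"
    and exp: "0 \<le> dual_exponent n"
  shows "Phi n A q \<le> Phi n A p + ennreal (t * (q - p) / p powr (1 + dual_exponent n))"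
proof -
  define d where "d = 1 + dual_exponent n"
  define f where "f t = young_conjugate A t / ennreal (t powr d)" for t
  have [measurable]: "f \<in> borel_measurable borel"
    unfolding f_def using borel_measurable_mono_ennreal[OF young_conjugate_mono[of A]]
    by measurable
  have bound: "f s \<le> ennreal (t / p powr d)" if "p < s" "s \<le> q" for s
  proof -
    have "young_conjugate A s \<le> ennreal t"
      using monoD[OF young_conjugate_mono, of s q A] that conj by simp
    moreover have "p powr d \<le> s powr d" using assms that by (intro powr_mono2) (auto simp: d_def)
    ultimately have "f s \<le> ennreal t / ennreal (s powr d)" and "t / s powr d \<le> t / p powr d"
      unfolding f_def using assms that
      by (auto intro!: divide_right_mono_ennreal divide_left_mono)
    moreover have "ennreal t / ennreal (s powr d) = ennreal (t / s powr d)"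
      using assms that by (intro divide_ennreal) auto
    ultimately show ?thesis by (metis ennreal_leI order_trans)
  qed
  have "Phi n A q = (\<integral>\<^sup>+t. f t * indicator {0<..q} t \<partial>lborel)"
    by (simp add: Phi_def f_def d_def)
  also have "\<dots> = (\<integral>\<^sup>+t. f t * indicator {0<..p} t + f t * indicator {p<..q} t \<partial>lborel)"
    using assms by (intro nn_integral_cong) (auto simp: indicator_def)
  also have "\<dots> = (\<integral>\<^sup>+t. f t * indicator {0<..p} t \<partial>lborel) + 
      (\<integral>\<^sup>+t. f t * indicator {p<..q} t \<partial>lborel)"
    by (rule nn_integral_add) auto
  also have "(\<integral>\<^sup>+t. f t * indicator {0<..p} t \<partial>lborel) = Phi n A p"
    by (simp add: Phi_def f_def d_def)
  also have "(\<integral>\<^sup>+t. f t * indicator {p<..q} t \<partial>lborel) \<le>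
      (\<integral>\<^sup>+s. ennreal (t / p powr d) * indicator {p<..p + (q - p)} s \<partial>lborel)"
    by (intro nn_integral_mono) (auto simp: indicator_def bound)
  also have "\<dots> = ennreal (t / p powr d) * ennreal (q - p)"
    using assms by (intro nn_integral_const_interval) auto
  also have "\<dots> = ennreal (t * (q - p) / p powr d)"
    using assms by (simp flip: ennreal_mult)
  finally show ?thesis by (simp add: d_def add_left_mono)
qed

lemma left_inverse_ge:
  assumes "Phi n A y < ennreal r"
  shows "ennreal y \<le> left_inverse (Phi n A) r"
  unfolding left_inverse_def
proof (rule INF_greatest)
  fix s assume "s \<in> {s. 0 \<le> s \<and> ennreal r \<le> Phi n A s}"
  thus "ennreal y \<le> ennreal s" using assms Phi_mono[of s y n A]
    by (intro ennreal_leI) (smt (verit) leD mem_Collect_eq order_trans)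
qed

text \<open>If the upper Boyd index of \<open>A\<close> is below \<open>n\<close>, this is, up to multiplicative constants, the
  inverse of the Sobolev conjugate near infinity.\<close>

definition sobolev_inv :: "nat \<Rightarrow> (real \<Rightarrow> ennreal) \<Rightarrow> real \<Rightarrow> real" where
  "sobolev_inv n A t = real_inverse A t * t powr (- 1 / real n)"

lemma sobolev_inv_pos: "young_function A \<Longrightarrow> 0 < t \<Longrightarrow> 0 < sobolev_inv n A t"
  by (simp add: sobolev_inv_def real_inverse_pos)

lemma dual_exponent_gt_1: "2 \<le> n \<Longrightarrow> 1 < dual_exponent n"
  by (auto simp: dual_exponent_def field_simps)

lemma sobolev_inv_powr:
  assumes "2 \<le> n" "0 < t"
  shows "sobolev_inv n A t powr dual_exponent n * (t / real_inverse A t) powr dual_exponent n = 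
    (if real_inverse A t = 0 then 0 else t)"
proof -
  have "1 - 1 / real n = 1 / dual_exponent n" "dual_exponent n > 0"
    using assms dual_exponent_gt_1[of n] by (auto simp: dual_exponent_def field_simps)
  moreover have "t powr (- 1 / real n) * t = t powr (1 - 1 / real n)"
    using assms powr_add[of t "- 1 / real n" 1] by simp
  ultimately have "(t powr (- 1 / real n) * t) powr dual_exponent n = t"
    using assms by (simp add: powr_powr)
  thus ?thesis
    using assms by (simp add: sobolev_inv_def flip: powr_mult)
qed

lemma secant_slope_mono:
  assumes A: "young_function A" and "0 < s" "s \<le> t"
  shows "s / real_inverse A s \<le> t / real_inverse A t"
  using real_inverse_sublinear[OF A, of s "t / s"] real_inverse_pos[OF A, of s] real_inverse_pos[OF A, of t] assms
  by (simp add: field_simps)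

lemma Phi_secant_slope_finite:
  assumes A: "young_function A" and n: "2 \<le> n" and fin: "\<exists>s>0. Phi n A s < \<infinity>" and t: "0 < t"
  shows "Phi n A (t / real_inverse A t) < \<infinity>"
proof -
  define y where "y = t / real_inverse A t"
  obtain s where s: "0 < s" "Phi n A s < \<infinity>" using fin by blast
  show ?thesis
  proof (cases "y \<le> s")
    case True
    thus ?thesis using Phi_mono[of y s n A] s by (auto simp: y_def intro: le_less_trans)
  next
    case False
    have "Phi n A y \<le> Phi n A s + ennreal (t * (y - s) / s powr (1 + dual_exponent n))"
      using False s t young_conjugate_secant_le[OF A t] dual_exponent_gt_1[OF n]
      by (intro Phi_increment_le) (auto simp: y_def)
    also have "\<dots> < \<infinity>" using s by simp
    finally show ?thesis by (simp add: y_def)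
  qed
qed

text \<open>When \<open>t\<close> is replaced by \<open>K * t\<close>, the value of \<open>Phi\<close> at the secant slope increases by at
  most a multiple of \<open>sobolev_inv n A t powr dual_exponent n\<close>, while the latter is itself
  multiplied by at least \<open>q powr dual_exponent n > 1\<close>. A bound with a large enough \<open>M\<close> is
  therefore inherited: the contributions to \<open>Phi\<close> form a geometric sum that is dominated by its
  last term.\<close>

lemma Phi_secant_slope_le:
  assumes A: "young_function A" and n: "2 \<le> n" and fin: "\<exists>s>0. Phi n A s < \<infinity>"
    and K: "1 < K" and q: "1 < q" and t1: "0 < t1"
    and growth: "\<And>t. t1 \<le> t \<Longrightarrow> q * K powr (1 / real n) * real_inverse A t \<le> real_inverse A (K * t)"
  shows "\<exists>M\<ge>0. \<exists>\<gamma>>0. \<forall>t\<ge>t1. \<gamma> \<le> sobolev_inv n A t \<and>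
    Phi n A (t / real_inverse A t) \<le> ennreal (M * sobolev_inv n A t powr dual_exponent n)"
proof -
  define d where "d = dual_exponent n"
  define g where "g = sobolev_inv n A"
  define y where "y t = t / real_inverse A t" for t
  have d: "1 < d" using dual_exponent_gt_1[OF n] by (simp add: d_def)
  have g_pos: "0 < g t" if "t1 \<le> t" for t using sobolev_inv_pos[OF A] t1 that by (simp add: g_def)
  have g_growth: "q * g t \<le> g (K * t)" if "t1 \<le> t" for t
  proof -
    have "q * g t = (q * K powr (1 / real n) * real_inverse A t) * (K * t) powr (- 1 / real n)"
      using t1 that K by (simp add: g_def sobolev_inv_def powr_mult powr_minus field_simps)
    also have "\<dots> \<le> g (K * t)"
      unfolding g_def sobolev_inv_def by (intro mult_right_mono growth that) auto
    finally show ?thesis .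
  qed
  \<comment> \<open>Both factors of \<open>g\<close> are monotone, in opposite directions, so on \<open>[t1, K * t1]\<close> the
    smallest value of each factor bounds it.\<close>
  define \<gamma> where "\<gamma> = real_inverse A t1 * (K * t1) powr (- 1 / real n)"
  have \<gamma>: "0 < \<gamma>" using real_inverse_pos[OF A t1] t1 K by (simp add: \<gamma>_def)
  have g_base: "\<gamma> \<le> g t" if "t1 \<le> t" "t \<le> K * t1" for t
    unfolding \<gamma>_def g_def sobolev_inv_def using that t1
    by (intro mult_mono real_inverse_mono[OF A] powr_mono2') auto
  have g_ge: "\<gamma> \<le> g t" if "t1 \<le> t" for t
    using K t1 g_base _ that
  proof (rule multiplicative_induct[where P = "\<lambda>t. \<gamma> \<le> g t"])
    fix t assume t: "t1 \<le> t" and IH: "\<gamma> \<le> g t"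
    have "1 * g t \<le> q * g t" using q g_pos[OF t] by (intro mult_right_mono) auto
    thus "\<gamma> \<le> g (K * t)" using g_growth[OF t] IH by simp
  qed
  obtain F where F: "Phi n A (y (K * t1)) = ennreal F" "0 \<le> F"
    using Phi_secant_slope_finite[OF A n fin, of "K * t1"] K t1
    by (cases "Phi n A (y (K * t1))") (auto simp: y_def)
  \<comment> \<open>The first entry starts the induction, the second one solves
    \<open>M + K * (K - 1) \<le> M * q powr d\<close>, which makes the induction step work.\<close>
  define M where "M = max (F / \<gamma> powr d) (K * (K - 1) / (q powr d - 1))"
  have M: "F \<le> M * \<gamma> powr d" using \<gamma> by (simp add: M_def flip: pos_divide_le_eq)
  have qd: "1 < q powr d" using q d by simp
  hence "K * (K - 1) \<le> M * (q powr d - 1)"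
    by (simp add: M_def flip: pos_divide_le_eq)
  hence M': "M + K * (K - 1) \<le> M * q powr d" by (simp add: algebra_simps)
  have M0: "0 \<le> M" using F by (simp add: M_def max.coboundedI1)
  have "Phi n A (y t) \<le> ennreal (M * g t powr d)" if "t1 \<le> t" for t
    using K t1 _ _ that
  proof (rule multiplicative_induct[where P = "\<lambda>t. Phi n A (y t) \<le> ennreal (M * g t powr d)"])
    fix t assume t: "t1 \<le> t" "t \<le> K * t1"
    have "Phi n A (y t) \<le> ennreal F"
      using Phi_mono[OF secant_slope_mono[OF A _ t(2)], of n A] t t1 F by (simp add: y_def)
    also have "F \<le> M * g t powr d"
      using M by (rule order_trans) (use M0 d \<gamma> g_ge[OF t(1)] in \<open>auto intro!: mult_left_mono powr_mono2\<close>)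
    finally show "Phi n A (y t) \<le> ennreal (M * g t powr d)" using ennreal_leI by blast
  next
    fix t assume t: "t1 \<le> t" and IH: "Phi n A (y t) \<le> ennreal (M * g t powr d)"
    have t0: "0 < t" "0 < K * t" "t \<le> K * t" using t t1 K by auto
    have b: "0 < real_inverse A t" "real_inverse A t \<le> real_inverse A (K * t)" 
      using real_inverse_pos[OF A t0(1)] real_inverse_mono[OF A t0(3)] by auto
    have y0: "0 < y t" using b t0 by (simp add: y_def)
    have y1: "y t \<le> y (K * t)" unfolding y_def by (intro secant_slope_mono[OF A] t0)
    have y2: "y (K * t) \<le> K * y t"
      using b t0 K by (simp add: y_def) (intro divide_left_mono; simp)
    have prod: "g t powr d * y t powr d = t"
      using sobolev_inv_powr[OF n t0(1), of A] b by (simp add: g_def d_def y_def)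
    have "K * t * (y (K * t) - y t) / y t powr (1 + d) \<le> K * t * ((K - 1) * y t) / y t powr (1 + d)"
      using y2 K t0 by (intro divide_right_mono mult_left_mono) (auto simp: algebra_simps)
    also have "\<dots> = K * (K - 1) * (t / y t powr d)"
      using y0 by (simp add: powr_add)
    also have "\<dots> = K * (K - 1) * g t powr d"
      using prod y0 by (simp add: field_simps)
    finally have inc: "K * t * (y (K * t) - y t) / y t powr (1 + d) \<le> K * (K - 1) * g t powr d" .
    have "Phi n A (y (K * t)) \<le> Phi n A (y t) + ennreal (K * t * (y (K * t) - y t) / y t powr (1 + d))"
      using young_conjugate_secant_le[OF A t0(2)] t0 y0 y1 d unfolding d_def
      by (intro Phi_increment_le) (auto simp: y_def)
    also have "\<dots> \<le> ennreal (M * g t powr d) + ennreal (K * (K - 1) * g t powr d)"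
      by (intro add_mono IH ennreal_leI inc)
    also have "\<dots> = ennreal ((M + K * (K - 1)) * g t powr d)"
      using M0 K by (simp add: distrib_right flip: ennreal_plus)
    also have "\<dots> \<le> ennreal (M * q powr d * g t powr d)"
      by (intro ennreal_leI mult_right_mono M') auto
    also have "M * q powr d * g t powr d = M * (q * g t) powr d"
      using q g_pos[OF t] by (simp add: powr_mult)
    also have "ennreal \<dots> \<le> ennreal (M * g (K * t) powr d)"
      using q g_pos[OF t] g_growth[OF t] M0 d by (intro ennreal_leI mult_left_mono powr_mono2) auto
    finally show "Phi n A (y (K * t)) \<le> ennreal (M * g (K * t) powr d)" .
  qed
  thus ?thesis using \<gamma> M0 g_ge unfolding g_def d_def y_def by blast
qed

lemma ennreal_powr_ge:
  assumes "ennreal y \<le> x" "0 \<le> y" "0 \<le> p"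
  shows "ennreal (y powr p) \<le> ennreal_powr x p"
  using assms by (cases x) (auto simp: ennreal_powr_def intro!: ennreal_leI powr_mono2)

text \<open>Beyond \<open>R * sobolev_inv n A t\<close> the inverse of \<open>Phi\<close> in the integrand is at least the
  secant slope, and one more interval of that length makes the integral reach \<open>t\<close>.\<close>

lemma sobolev_conjugate_ge:
  assumes A: "young_function A" and n: "2 \<le> n" and t: "0 < t"
    and Phi: "Phi n A (t / real_inverse A t) \<le> ennreal (M * sobolev_inv n A t powr dual_exponent n)"
    and R: "1 \<le> R" "M < R powr dual_exponent n"
  shows "ennreal t \<le> sobolev_conjugate n A (2 * R * sobolev_inv n A t)"
proof -
  define d where "d = dual_exponent n"
  define y where "y = t / real_inverse A t"
  define r0 where "r0 = R * sobolev_inv n A t"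
  have d: "1 < d" using dual_exponent_gt_1[OF n] by (simp add: d_def)
  have g: "0 < sobolev_inv n A t" by (rule sobolev_inv_pos[OF A t])
  have r0: "0 < r0" using R g by (simp add: r0_def)
  have y: "0 < y" using t real_inverse_pos[OF A t] by (simp add: y_def)
  have inverse: "ennreal y \<le> left_inverse (Phi n A) (r powr d)" if "r0 \<le> r" for r
  proof (rule left_inverse_ge)
    have "M * sobolev_inv n A t powr d < R powr d * sobolev_inv n A t powr d"
      using R g by (intro mult_strict_right_mono) (auto simp: d_def)
    also have "\<dots> = r0 powr d" using R g by (simp add: r0_def powr_mult)
    also have "\<dots> \<le> r powr d" using that r0 d by (intro powr_mono2) auto
    finally have "M * sobolev_inv n A t powr d < r powr d" .
    moreover have "0 < r powr d" using r0 that by simp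
    ultimately have "ennreal (M * sobolev_inv n A t powr d) < ennreal (r powr d)"
      by (rule ennreal_lessI[rotated])
    thus "Phi n A y < ennreal (r powr d)" using Phi by (simp add: y_def d_def)
  qed
  have "t \<le> r0 powr d * y powr d"
  proof -
    have "t = 1 * (sobolev_inv n A t powr d * y powr d)"
      using sobolev_inv_powr[OF n t, of A] real_inverse_pos[OF A t] by (simp add: d_def y_def)
    also have "\<dots> \<le> R powr d * (sobolev_inv n A t powr d * y powr d)"
      using R d by (intro mult_right_mono ge_one_powr_ge_zero) auto
    finally show ?thesis using R g by (simp add: r0_def powr_mult)
  qed
  hence "ennreal t \<le> ennreal (r0 powr d * y powr d)" by (rule ennreal_leI)
  also have "r0 powr d * y powr d = r0 powr (d - 1) * y powr d * r0"
    using r0 powr_add[of r0 "d - 1" 1] by simp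
  also have "ennreal \<dots> = (\<integral>\<^sup>+r. ennreal (r0 powr (d - 1) * y powr d) * indicator {r0<..r0+r0} r \<partial>lborel)"
    using r0 by (subst nn_integral_const_interval) (auto simp: ennreal_mult)
  also have "\<dots> \<le> sobolev_conjugate n A (2 * r0)"
    unfolding sobolev_conjugate_def d_def[symmetric]
  proof (intro nn_integral_mono)
    fix r
    have "ennreal (r0 powr (d - 1) * y powr d) \<le> 
        ennreal (r powr (d - 1)) * ennreal_powr (left_inverse (Phi n A) (r powr d)) d" if "r0 \<le> r"
      using that r0 d y inverse[OF that] 
      by (subst ennreal_mult) (auto intro!: mult_mono ennreal_leI powr_mono2 ennreal_powr_ge)
    thus "ennreal (r0 powr (d - 1) * y powr d) * indicator {r0<..r0+r0} r \<le>
        ennreal (r powr (d - 1)) * ennreal_powr (left_inverse (Phi n A) (r powr d)) d * 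
        indicator {0<..2 * r0} r"
      using r0 by (auto simp: indicator_def)
  qed
  finally show ?thesis by (simp add: r0_def mult.assoc)
qed

text \<open>This is how the Boyd index and the condition at 0 enter the geometric argument. The lower
  bound \<open>\<gamma>\<close> serves to push the argument of the Sobolev conjugate into the range in which it is
  dominated by \<open>B\<close>.\<close>

lemma sobolev_conjugate_inverse_bound:
  assumes A: "young_function A" and n: "2 \<le> n" and fin: "\<exists>s>0. Phi n A s < \<infinity>"
    and index: "local_upper_boyd_index A < ereal (real n)"
    and dom: "dominates_near_infinity B (sobolev_conjugate n A)"
  obtains C t1 where "0 < C" "0 < t1" "\<And>t. t1 \<le> t \<Longrightarrow> ennreal t \<le> B (C * sobolev_inv n A t)"
proof -
  have n0: "0 < real n" using n by simp
  obtain K q t1 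
    where K: "1 < K" "1 < q" and t1: "0 < t1"
      and growth: "\<And>t. t1 \<le> t \<Longrightarrow> q * K powr (1 / real n) * real_inverse A t \<le> real_inverse A (K * t)"
    by (rule boyd_index_imp_inverse_growth[OF A n0 index]) blast
  obtain M \<gamma> where \<gamma>: "0 < \<gamma>" and M: "0 \<le> M"
    and g_ge: "\<And>t. t1 \<le> t \<Longrightarrow> \<gamma> \<le> sobolev_inv n A t"
    and Phi_le: "\<And>t. t1 \<le> t \<Longrightarrow> 
      Phi n A (t / real_inverse A t) \<le> ennreal (M * sobolev_inv n A t powr dual_exponent n)"
    using Phi_secant_slope_le[OF A n fin K t1 growth] by metis
  obtain c s0 where c: "0 < c" and s0: "0 < s0" 
    and B: "\<And>s. s0 \<le> s \<Longrightarrow> sobolev_conjugate n A s \<le> B (c * s)"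
    using dom unfolding dominates_near_infinity_def by blast
  have d: "1 < dual_exponent n" by (rule dual_exponent_gt_1[OF n])
  define R where "R = max (M + 1) (s0 / \<gamma>)"
  have R: "1 \<le> R" "M + 1 \<le> R" "s0 \<le> R * \<gamma>"
    using M \<gamma> by (auto simp: R_def simp flip: pos_divide_le_eq)
  have "R powr 1 \<le> R powr dual_exponent n" using R d by (intro powr_mono) auto
  hence R': "M < R powr dual_exponent n" using R by simp
  show thesis
  proof
    show "0 < c * (2 * R)" using c R by simp
    show "0 < t1" by fact
    fix t assume t: "t1 \<le> t"
    have "s0 \<le> R * sobolev_inv n A t" 
      using R(3) by (rule order_trans) (use R g_ge[OF t] in \<open>auto intro!: mult_left_mono\<close>)
    hence "s0 \<le> 2 * R * sobolev_inv n A t" using s0 by simp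
    from B[OF this] sobolev_conjugate_ge[OF A n _ Phi_le[OF t] R(1) R'] t t1
    show "ennreal t \<le> B (c * (2 * R) * sobolev_inv n A t)"
      by (auto simp: mult.assoc intro: order_trans)
  qed
qed

section \<open>Weak derivatives of continuously differentiable functions\<close>

lemma difference_le_directional_derivative_bound:
  fixes f :: "'a::euclidean_space \<Rightarrow> real"
  assumes deriv: "\<And>z. (f has_derivative f' z) (at z)" and bound: "\<And>z. \<bar>f' z v\<bar> \<le> L" and h: "0 < h"
  shows "\<bar>f (z + h *\<^sub>R v) - f z\<bar> \<le> L * h"
proof -
  have "((\<lambda>t. f (z + t *\<^sub>R v)) has_real_derivative f' (z + t *\<^sub>R v) v) (at t)" for t
  proof -
    have "((\<lambda>t. f (z + t *\<^sub>R v)) has_derivative (\<lambda>s. f' (z + t *\<^sub>R v) (s *\<^sub>R v))) (at t)"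
      by (rule has_derivative_compose[OF _ deriv]) (auto intro!: derivative_eq_intros)
    moreover have "linear (f' (z + t *\<^sub>R v))"
      using deriv by (blast intro: has_derivative_linear)
    ultimately show ?thesis
      by (simp add: has_field_derivative_def linear_cmul mult.commute[of _ "f' (z + t *\<^sub>R v) v"])
  qed
  hence "\<exists>t>0. t < h \<and> f (z + h *\<^sub>R v) - f (z + 0 *\<^sub>R v) = (h - 0) * f' (z + t *\<^sub>R v) v"
    using h by (intro MVT2) auto
  then obtain t where "f (z + h *\<^sub>R v) - f z = h * f' (z + t *\<^sub>R v) v" by auto
  thus ?thesis using bound[of "z + t *\<^sub>R v"] h by (simp add: abs_mult mult.commute)
qed

text \<open>The integral of each difference quotient vanishes by translation invariance.\<close>

lemma integral_directional_derivative_eq_0: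
  fixes f :: "'a::euclidean_space \<Rightarrow> real"
  assumes deriv: "\<And>z. (f has_derivative f' z) (at z)" and bound: "\<And>z. \<bar>f' z v\<bar> \<le> L"
    and supp: "\<And>z. z \<notin> S \<Longrightarrow> f z = 0" and S: "bounded S"
  shows "integral\<^sup>L lborel (\<lambda>z. f' z v) = 0"
proof -
  obtain R where R: "\<And>z. z \<in> S \<Longrightarrow> norm z \<le> R" using S by (auto simp: bounded_iff)
  have cont: "continuous_on UNIV f"
    using deriv by (meson continuous_at_imp_continuous_on has_derivative_continuous)
  hence [measurable]: "f \<in> borel_measurable borel" by (rule borel_measurable_continuous_onI)
  have L0: "0 \<le> L" using bound[of 0] by linarith
  define s where "s k z = (f (z + (1 / real (Suc k)) *\<^sub>R v) - f z) * real (Suc k)" for k z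
  have s_lim: "(\<lambda>k. s k z) \<longlonglongrightarrow> f' z v" for z
  proof -
    have "((\<lambda>t. f (z + t *\<^sub>R v)) has_derivative (\<lambda>s. f' z (s *\<^sub>R v))) (at 0)"
    proof (rule has_derivative_compose[of _ "\<lambda>s. s *\<^sub>R v" _ _ f])
      show "(f has_derivative f' z) (at (z + 0 *\<^sub>R v))" using deriv by simp
    qed (auto intro!: derivative_eq_intros)
    moreover have "linear (f' z)"
      using deriv by (blast intro: has_derivative_linear)
    ultimately have "((\<lambda>t. f (z + t *\<^sub>R v)) has_real_derivative f' z v) (at 0)"
      by (simp add: has_field_derivative_def linear_cmul mult.commute[of _ "f' z v"])
    hence "((\<lambda>h. (f (z + h *\<^sub>R v) - f z) / h) \<longlongrightarrow> f' z v) (at 0)"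
      by (simp add: DERIV_def)
    moreover have "filterlim (\<lambda>k. 1 / real (Suc k)) (at 0) sequentially"
      using LIMSEQ_inverse_real_of_nat by (auto simp: filterlim_at inverse_eq_divide)
    ultimately have "(\<lambda>k. (f (z + (1 / real (Suc k)) *\<^sub>R v) - f z) / (1 / real (Suc k))) \<longlonglongrightarrow> f' z v"
      by (rule filterlim_compose)
    thus ?thesis by (simp add: s_def)
  qed
  have s_bound: "norm (s k z) \<le> indicator (cball 0 (R + norm v)) z *\<^sub>R L" for k z
  proof (cases "norm z \<le> R + norm v")
    case True
    have "\<bar>f (z + (1 / real (Suc k)) *\<^sub>R v) - f z\<bar> \<le> L * (1 / real (Suc k))"
      by (rule difference_le_directional_derivative_bound[OF deriv bound]) auto
    hence "\<bar>f (z + (1 / real (Suc k)) *\<^sub>R v) - f z\<bar> * real (Suc k) \<le> L"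
      by (simp add: field_simps del: of_nat_Suc)
    thus ?thesis using True by (simp add: s_def abs_mult del: of_nat_Suc)
  next
    case False
    have "norm z \<le> norm (z + (1 / real (Suc k)) *\<^sub>R v) + norm ((1 / real (Suc k)) *\<^sub>R v)"
      by (metis add_diff_cancel_right' norm_triangle_ineq4)
    moreover have "norm ((1 / real (Suc k)) *\<^sub>R v) \<le> norm v"
      by (simp add: field_simps mult_le_cancel_right1)
    ultimately have "z + (1 / real (Suc k)) *\<^sub>R v \<notin> S" "z \<notin> S"
      using R[of z] R[of "z + (1 / real (Suc k)) *\<^sub>R v"] False norm_ge_zero[of v] by linarith+
    thus ?thesis using L0 by (simp add: s_def supp indicator_def)
  qed
  have s_int: "integral\<^sup>L lborel (s k) = 0" for k
  proof -
    have f_int: "integrable lborel f"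
    proof -
      have "integrable lborel (\<lambda>x. indicator (cball 0 R) x *\<^sub>R f x)"
        by (intro borel_integrable_compact continuous_on_subset[OF cont]) auto
      also have "(\<lambda>x. indicator (cball 0 R) x *\<^sub>R f x) = f"
        using supp R by (auto simp: fun_eq_iff indicator_def)
      finally show ?thesis .
    qed
    define c where "c = (1 / real (Suc k)) *\<^sub>R v"
    have "integrable (distr lborel borel ((+) c)) f" 
      by (subst lborel_distr_plus) (rule f_int)
    hence f_int': "integrable lborel (\<lambda>z. f (c + z))"
      by (subst (asm) integrable_distr_eq) auto
    have "integral\<^sup>L lborel f = integral\<^sup>L (distr lborel borel ((+) c)) f" 
      by (subst lborel_distr_plus) simp
    also have "\<dots> = integral\<^sup>L lborel (\<lambda>z. f (c + z))"
      by (subst integral_distr) auto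
    finally have "integral\<^sup>L lborel (\<lambda>z. f (c + z) - f z) = 0"
      using f_int f_int' by simp
    thus ?thesis by (simp add: s_def[abs_def] c_def add.commute)
  qed
  have [measurable]: "s k \<in> borel_measurable borel" for k unfolding s_def[abs_def] by measurable
  have [measurable]: "(\<lambda>z. f' z v) \<in> borel_measurable borel"
    by (rule borel_measurable_LIMSEQ_metric[OF _ s_lim]) auto
  have "(\<lambda>k. integral\<^sup>L lborel (s k)) \<longlonglongrightarrow> integral\<^sup>L lborel (\<lambda>z. f' z v)"
  proof (rule integral_dominated_convergence)
    show "integrable lborel (\<lambda>z. indicator (cball 0 (R + norm v)) z *\<^sub>R L)"
      by (intro borel_integrable_compact) auto
  qed (use s_lim s_bound in auto)
  thus ?thesis by (simp add: s_int LIMSEQ_const_iff)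
qed

lemma integrable_continuous_compact_support:
  fixes g :: "'a::euclidean_space \<Rightarrow> real"
  assumes "continuous_on UNIV g" "compact K" "\<And>z. z \<notin> K \<Longrightarrow> g z = 0"
  shows "integrable lborel g"
proof -
  have "integrable lborel (\<lambda>x. indicator K x *\<^sub>R g x)"
    using assms by (intro borel_integrable_compact continuous_on_subset[OF assms(1)]) auto
  also have "(\<lambda>x. indicator K x *\<^sub>R g x) = g" using assms by (auto simp: fun_eq_iff indicator_def)
  finally show ?thesis .
qed

lemma bounded_continuous_compact_support:
  fixes g :: "'a::euclidean_space \<Rightarrow> real"
  assumes "continuous_on UNIV g" "compact K" "\<And>z. z \<notin> K \<Longrightarrow> g z = 0"
  shows "\<exists>L. \<forall>z. \<bar>g z\<bar> \<le> L"
proof -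
  have "bounded (g ` K)"
    using assms by (intro compact_imp_bounded compact_continuous_image continuous_on_subset[OF assms(1)]) auto
  then obtain L where "\<And>z. z \<in> K \<Longrightarrow> \<bar>g z\<bar> \<le> L" by (auto simp: bounded_iff)
  hence "\<bar>g z\<bar> \<le> max L 0" for z using assms(3)[of z] by (cases "z \<in> K") (auto simp: le_max_iff_disj)
  thus ?thesis by blast
qed

lemma set_integral_lebesgue_compact_support:
  fixes g :: "real^'n \<Rightarrow> real"
  assumes "continuous_on UNIV g" "\<And>z. z \<notin> \<Omega> \<Longrightarrow> g z = 0"
  shows "(LINT x:\<Omega>|lebesgue. g x) = integral\<^sup>L lborel g"
proof -
  have "(\<lambda>x. indicator \<Omega> x *\<^sub>R g x) = g" using assms by (auto simp: fun_eq_iff indicator_def)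
  moreover have "g \<in> borel_measurable lborel"
    using borel_measurable_continuous_onI[OF assms(1)] by simp
  ultimately show ?thesis by (simp add: set_lebesgue_integral_def integral_completion)
qed

lemma continuous_locally_integrable_on:
  fixes u :: "real^'n \<Rightarrow> real"
  assumes "continuous_on UNIV u"
  shows "u locally_integrable_on \<Omega>"
  unfolding locally_integrable_on_def set_integrable_def
proof (intro allI impI, elim conjE)
  fix K :: "(real^'n) set" assume "compact K"
  hence int: "integrable lborel (\<lambda>x. indicator K x *\<^sub>R u x)"
    by (intro borel_integrable_compact continuous_on_subset[OF assms]) auto
  thus "integrable lebesgue (\<lambda>x. indicator K x *\<^sub>R u x)"
    using integrable_completion[OF borel_measurable_integrable[OF int]] by simp
qed

text \<open>The support of a test function is a compact subset of \<open>\<Omega>\<close>, off which the function vanishes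
  near each point and so has vanishing partial derivatives as well.\<close>

lemma test_function_properties:
  fixes \<phi> :: "real^'n \<Rightarrow> real"
  assumes "test_function \<Omega> \<phi>"
  obtains K where "compact K" "K \<subseteq> \<Omega>" "\<And>z. z \<notin> K \<Longrightarrow> \<phi> z = 0"
    "\<And>z i. z \<notin> K \<Longrightarrow> partial_deriv i \<phi> z = 0"
    "\<And>z. (\<phi> has_derivative frechet_derivative \<phi> (at z)) (at z)"
    "continuous_on UNIV \<phi>" "\<And>i. continuous_on UNIV (partial_deriv i \<phi>)"
proof
  define K where "K = closure {x. \<phi> x \<noteq> 0}"
  show "compact K" "K \<subseteq> \<Omega>" using assms by (auto simp: test_function_def K_def)
  show zero: "\<phi> z = 0" if "z \<notin> K" for z using that closure_subset by (force simp: K_def)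
  have "C_k 0 \<phi>" "C_k (Suc 0) \<phi>" using assms unfolding test_function_def by blast+
  thus deriv: "(\<phi> has_derivative frechet_derivative \<phi> (at z)) (at z)" 
    and "continuous_on UNIV \<phi>" "continuous_on UNIV (partial_deriv i \<phi>)" for z i
    by (auto simp: frechet_derivative_works)
  show "partial_deriv i \<phi> z = 0" if "z \<notin> K" for z i
  proof -
    have "(\<phi> has_derivative (\<lambda>_. 0)) (at z)"
    proof (rule has_derivative_transform_within_open)
      show "((\<lambda>_. 0) has_derivative (\<lambda>_. 0)) (at z)" by simp
      show "open (- K)" "z \<in> - K" using that by (auto simp: K_def)
      show "0 = \<phi> y" if "y \<in> - K" for y using zero that by simp
    qed
    from frechet_derivative_at[OF this, symmetric] show ?thesis
      by (simp only: partial_deriv_def)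
  qed
qed

text \<open>For a test function \<open>\<phi>\<close> the product \<open>u * \<phi>\<close> is differentiable on the whole space, with compact
  support and bounded \<open>i\<close>-th partial derivative, so the integral of that derivative vanishes.\<close>

lemma weak_partial_deriv_C1:
  fixes u :: "real^'n \<Rightarrow> real"
  assumes deriv: "\<And>z. (u has_derivative u' z) (at z)" 
    and cont': "continuous_on UNIV (\<lambda>z. u' z (axis i 1))"
  shows "weak_partial_deriv \<Omega> i u (\<lambda>z. u' z (axis i 1))"
  unfolding weak_partial_deriv_def
proof (intro conjI allI impI)
  have cont: "continuous_on UNIV u"
    using deriv by (meson continuous_at_imp_continuous_on has_derivative_continuous)
  show "u locally_integrable_on \<Omega>" "(\<lambda>z. u' z (axis i 1)) locally_integrable_on \<Omega>"
    by (intro continuous_locally_integrable_on cont cont')+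
  fix \<phi> assume "test_function \<Omega> \<phi>"
  then obtain K where K: "compact K" "K \<subseteq> \<Omega>" and zero: "\<And>z. z \<notin> K \<Longrightarrow> \<phi> z = 0"
    "\<And>z i. z \<notin> K \<Longrightarrow> partial_deriv i \<phi> z = 0"
    and \<phi>: "\<And>z. (\<phi> has_derivative frechet_derivative \<phi> (at z)) (at z)"
    "continuous_on UNIV \<phi>" "\<And>i. continuous_on UNIV (partial_deriv i \<phi>)"
    by (rule test_function_properties) blast
  define g where "g z = u z * partial_deriv i \<phi> z" for z
  define h where "h z = u' z (axis i 1) * \<phi> z" for z
  have g: "continuous_on UNIV g" "\<And>z. z \<notin> K \<Longrightarrow> g z = 0"
    and h: "continuous_on UNIV h" "\<And>z. z \<notin> K \<Longrightarrow> h z = 0"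
    using zero by (auto simp: g_def[abs_def] h_def[abs_def] intro!: continuous_intros cont cont' \<phi>)
  have gh: "continuous_on UNIV (\<lambda>z. g z + h z)" "\<And>z. z \<notin> K \<Longrightarrow> g z + h z = 0"
    using g h by (auto intro!: continuous_intros)
  define f' where "f' z v = u z * frechet_derivative \<phi> (at z) v + u' z v * \<phi> z" for z v
  have f': "f' z (axis i 1) = g z + h z" for z
    by (simp add: f'_def g_def h_def partial_deriv_def)
  have "((\<lambda>z. u z * \<phi> z) has_derivative f' z) (at z)" for z
    unfolding f'_def by (intro has_derivative_mult deriv \<phi>)
  moreover obtain L where "\<And>z. \<bar>f' z (axis i 1)\<bar> \<le> L"
    using bounded_continuous_compact_support[OF gh(1) K(1) gh(2)] unfolding f' by blast
  ultimately have "integral\<^sup>L lborel (\<lambda>z. f' z (axis i 1)) = 0"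
    by (rule integral_directional_derivative_eq_0[where S = K])
       (auto simp: zero intro: compact_imp_bounded K)
  hence "integral\<^sup>L lborel g + integral\<^sup>L lborel h = 0"
    unfolding f' using integrable_continuous_compact_support[OF g(1) K(1) g(2)] 
      integrable_continuous_compact_support[OF h(1) K(1) h(2)] by simp
  moreover have "(LINT x:\<Omega>|lebesgue. g x) = integral\<^sup>L lborel g"
    "(LINT x:\<Omega>|lebesgue. h x) = integral\<^sup>L lborel h"
    using K g h by (auto intro!: set_integral_lebesgue_compact_support)
  ultimately show "(LINT x:\<Omega>|lebesgue. u x * partial_deriv i \<phi> x) =
      - (LINT x:\<Omega>|lebesgue. u' x (axis i 1) * \<phi> x)"
    by (simp add: g_def h_def)
qed

section \<open>Radial cutoff functions\<close>

text \<open>The integrated hat function: a quadratic spline rising from 0 to 1 on \<open>[0, 1]\<close>. In terms of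
  truncated squares its differentiability at the three knots is that of a single function
  at 0.\<close>

definition smooth_step :: "real \<Rightarrow> real" where
  "smooth_step t = 2 * (max 0 t)\<^sup>2 - 4 * (max 0 (t - 1 / 2))\<^sup>2 + 2 * (max 0 (t - 1))\<^sup>2"

definition smooth_step_deriv :: "real \<Rightarrow> real" where
  "smooth_step_deriv t = 4 * max 0 t - 8 * max 0 (t - 1 / 2) + 4 * max 0 (t - 1)"

lemma has_real_derivative_max_0_squared:
  fixes t :: real
  shows "((\<lambda>t. (max 0 t)\<^sup>2) has_real_derivative 2 * max 0 t) (at t)"
proof (cases t "0::real" rule: linorder_cases)
  case less
  have "((\<lambda>t::real. 0::real) has_real_derivative 0) (at t)" by simp
  thus ?thesis using less
    by (subst DERIV_cong_ev[OF refl _ refl, of _ "\<lambda>_. 0"])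
       (auto intro!: eventually_nhds[THEN iffD2] exI[of _ "{..<0}"])
next
  case equal
  have "((\<lambda>h::real. max 0 h * (if h \<le> 0 then 0 else 1)) \<longlongrightarrow> 0) (at 0)"
    by (rule Lim_null_comparison[of _ "\<lambda>h. \<bar>h\<bar>"]) (auto intro!: tendsto_eq_intros)
  moreover have "max 0 h * (if h \<le> 0 then 0 else 1) = (max 0 h)\<^sup>2 / h" for h :: real
    by (auto simp: max_def power2_eq_square)
  ultimately show ?thesis using equal by (simp add: DERIV_def)
next
  case greater
  have "((\<lambda>t::real. t\<^sup>2) has_real_derivative 2 * t) (at t)"
    by (auto intro!: derivative_eq_intros)
  thus ?thesis using greater
    by (subst DERIV_cong_ev[OF refl _ refl, of _ "\<lambda>t. t\<^sup>2"])
       (auto intro!: eventually_nhds[THEN iffD2] exI[of _ "{0<..}"])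
qed

lemma smooth_step_has_derivative:
  "(smooth_step has_real_derivative smooth_step_deriv t) (at t)"
  unfolding smooth_step_def[abs_def] smooth_step_deriv_def
  by (rule derivative_eq_intros has_real_derivative_max_0_squared
        DERIV_chain2[OF has_real_derivative_max_0_squared] | simp)+

lemma smooth_step_le_0: "t \<le> 0 \<Longrightarrow> smooth_step t = 0" "t \<le> 0 \<Longrightarrow> smooth_step_deriv t = 0"
  by (auto simp: smooth_step_def smooth_step_deriv_def max_def)

lemma smooth_step_ge_1: "1 \<le> t \<Longrightarrow> smooth_step t = 1"
  by (auto simp: smooth_step_def max_def power2_eq_square algebra_simps)

lemma smooth_step_bounds: "0 \<le> smooth_step t" "smooth_step t \<le> 1"
proof -
  consider "t \<le> 0" | "0 \<le> t" "t \<le> 1 / 2" | "1 / 2 \<le> t" "t \<le> 1" | "1 \<le> t" by linarith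
  hence "0 \<le> smooth_step t \<and> smooth_step t \<le> 1"
  proof cases
    case 2
    hence "t\<^sup>2 \<le> (1 / 2)\<^sup>2" by (intro power_mono) auto
    moreover have "smooth_step t = 2 * t\<^sup>2" using 2 by (auto simp: smooth_step_def max_def)
    ultimately show ?thesis by (simp add: power2_eq_square)
  next
    case 3
    hence "(1 - t)\<^sup>2 \<le> (1 / 2)\<^sup>2" by (intro power_mono) auto
    moreover have "smooth_step t = 1 - 2 * (1 - t)\<^sup>2"
      using 3 by (auto simp: smooth_step_def max_def power2_eq_square algebra_simps)
    ultimately show ?thesis by (simp add: power2_eq_square)
  qed (auto simp: smooth_step_le_0 smooth_step_ge_1)
  thus "0 \<le> smooth_step t" "smooth_step t \<le> 1" by auto
qed

lemma smooth_step_deriv_bounds: "\<bar>smooth_step_deriv t\<bar> \<le> 2"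
  by (auto simp: smooth_step_deriv_def max_def)

lemma continuous_smooth_step_deriv: "continuous_on UNIV smooth_step_deriv"
  unfolding smooth_step_deriv_def[abs_def] by (intro continuous_intros)

text \<open>The square of the distance, rather than the distance, keeps the function differentiable
  at the centre.\<close>

definition cutoff :: "'a::euclidean_space \<Rightarrow> real \<Rightarrow> real \<Rightarrow> 'a \<Rightarrow> real" where
  "cutoff x s r z = smooth_step ((r\<^sup>2 - (z - x) \<bullet> (z - x)) / (r\<^sup>2 - s\<^sup>2))"

definition cutoff_deriv :: "'a::euclidean_space \<Rightarrow> real \<Rightarrow> real \<Rightarrow> 'a \<Rightarrow> 'a \<Rightarrow> real" where
  "cutoff_deriv x s r z v =
     smooth_step_deriv ((r\<^sup>2 - (z - x) \<bullet> (z - x)) / (r\<^sup>2 - s\<^sup>2)) * (- 2 * ((z - x) \<bullet> v) / (r\<^sup>2 - s\<^sup>2))"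

lemma cutoff_has_derivative:
  assumes "0 \<le> s" "s < r"
  shows "(cutoff x s r has_derivative cutoff_deriv x s r z) (at z)"
proof -
  have "((\<lambda>z. (r\<^sup>2 - (z - x) \<bullet> (z - x)) / (r\<^sup>2 - s\<^sup>2)) has_derivative 
      (\<lambda>v. - 2 * ((z - x) \<bullet> v) / (r\<^sup>2 - s\<^sup>2))) (at z)"
    unfolding divide_inverse
    by (rule derivative_eq_intros refl | simp add: inner_commute algebra_simps)+
  from has_derivative_compose[OF this smooth_step_has_derivative[unfolded has_field_derivative_def]]
  show ?thesis
    by (simp add: cutoff_def[abs_def] cutoff_deriv_def[abs_def])
qed

lemma continuous_cutoff_deriv: "continuous_on UNIV (\<lambda>z. cutoff_deriv x s r z v)"
  unfolding cutoff_deriv_def divide_inverse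
  by (intro continuous_intros continuous_on_compose2[OF continuous_smooth_step_deriv]) auto

lemma cutoff_bounds: "0 \<le> cutoff x s r z" "cutoff x s r z \<le> 1"
  by (simp_all add: cutoff_def smooth_step_bounds)

lemma cutoff_outside:
  assumes "0 \<le> s" "s < r" "z \<notin> ball x r"
  shows "cutoff x s r z = 0" "cutoff_deriv x s r z v = 0"
proof -
  have "r\<^sup>2 \<le> (norm (z - x))\<^sup>2"
    using assms by (intro power_mono) (auto simp: dist_norm norm_minus_commute)
  moreover have "s\<^sup>2 < r\<^sup>2" using assms by (intro power_strict_mono) auto
  ultimately have "(r\<^sup>2 - (z - x) \<bullet> (z - x)) / (r\<^sup>2 - s\<^sup>2) \<le> 0"
    by (auto simp: power2_norm_eq_inner intro: divide_nonpos_nonneg)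
  thus "cutoff x s r z = 0" "cutoff_deriv x s r z v = 0"
    by (simp_all add: cutoff_def cutoff_deriv_def smooth_step_le_0)
qed

lemma cutoff_inside:
  assumes "0 \<le> s" "s < r" "z \<in> ball x s"
  shows "cutoff x s r z = 1"
proof -
  have "(norm (z - x))\<^sup>2 \<le> s\<^sup>2"
    using assms by (intro power_mono) (auto simp: dist_norm norm_minus_commute)
  moreover have "s\<^sup>2 < r\<^sup>2" using assms by (intro power_strict_mono) auto
  ultimately have "1 \<le> (r\<^sup>2 - (z - x) \<bullet> (z - x)) / (r\<^sup>2 - s\<^sup>2)"
    by (simp add: power2_norm_eq_inner pos_le_divide_eq)
  thus ?thesis by (simp add: cutoff_def smooth_step_ge_1)
qed

lemma cutoff_deriv_bound:
  assumes s: "0 \<le> s" "s < r" and v: "norm v \<le> 1"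
  shows "\<bar>cutoff_deriv x s r z v\<bar> \<le> 4 / (r - s)"
proof (cases "z \<in> ball x r")
  case True
  have factor: "r\<^sup>2 - s\<^sup>2 = (r - s) * (r + s)" by (simp add: power2_eq_square algebra_simps)
  have "\<bar>(z - x) \<bullet> v\<bar> \<le> norm (z - x) * norm v" by (rule Cauchy_Schwarz_ineq2)
  also have "\<dots> \<le> r * 1" using True v s by (intro mult_mono) (auto simp: dist_norm norm_minus_commute)
  finally have "\<bar>(z - x) \<bullet> v\<bar> \<le> r + s" using s by simp
  hence "\<bar>(z - x) \<bullet> v\<bar> / (r\<^sup>2 - s\<^sup>2) \<le> (r + s) / (r\<^sup>2 - s\<^sup>2)"
    using s by (intro divide_right_mono) (auto simp: factor)
  also have "\<dots> = 1 / (r - s)" using s by (simp add: factor)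
  finally have 1: "\<bar>(z - x) \<bullet> v\<bar> / (r\<^sup>2 - s\<^sup>2) \<le> 1 / (r - s)" .
  have "\<bar>r\<^sup>2 - s\<^sup>2\<bar> = r\<^sup>2 - s\<^sup>2" using s by (simp add: factor)
  hence "\<bar>cutoff_deriv x s r z v\<bar> =
      \<bar>smooth_step_deriv ((r\<^sup>2 - (z - x) \<bullet> (z - x)) / (r\<^sup>2 - s\<^sup>2))\<bar> * (2 * (\<bar>(z - x) \<bullet> v\<bar> / (r\<^sup>2 - s\<^sup>2)))"
    by (simp add: cutoff_deriv_def abs_mult abs_divide)
  also have "\<dots> \<le> 2 * (2 * (1 / (r - s)))"
    using 1 s by (intro mult_mono smooth_step_deriv_bounds) (auto simp: factor)
  finally show ?thesis by simp
next
  case False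
  thus ?thesis using cutoff_outside[OF s False] s by simp
qed

section \<open>Norms of bounded functions supported in small sets\<close>

text \<open>Divided by \<open>2 * \<kappa> / A\<^sup>-\<^sup>1(1 / m)\<close>, the values of \<open>f\<close> are at most half of \<open>A\<^sup>-\<^sup>1(1 / m)\<close>, where
  \<open>A\<close> is at most \<open>1 / m\<close>. The factor 2 avoids the point \<open>A\<^sup>-\<^sup>1(1 / m)\<close> itself, beyond which \<open>A\<close>
  may jump to \<open>\<infinity>\<close>.\<close>

lemma orlicz_norm_bounded_le:
  fixes f :: "real^'n \<Rightarrow> real"
  assumes A: "young_function A" and \<Omega>: "\<Omega> \<in> sets lebesgue" and S: "S \<in> sets lebesgue"
    and f: "f \<in> borel_measurable borel" and \<kappa>: "0 < \<kappa>"
    and bound: "\<And>z. \<bar>f z\<bar> \<le> \<kappa>" and supp: "\<And>z. z \<notin> S \<Longrightarrow> f z = 0"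
    and m: "emeasure lebesgue (S \<inter> \<Omega>) = ennreal m" "0 < m"
  shows "f \<in> orlicz_space A \<Omega>" "orlicz_norm A \<Omega> f \<le> ennreal (2 * \<kappa> / real_inverse A (1 / m))"
proof -
  define b where "b = real_inverse A (1 / m)"
  have b: "0 < b" using real_inverse_pos[OF A] m by (simp add: b_def)
  define \<mu> where "\<mu> = 2 * \<kappa> / b"
  have \<mu>: "0 < \<mu>" "\<kappa> / \<mu> = b / 2" using b \<kappa> by (simp_all add: \<mu>_def)
  have "(\<integral>\<^sup>+x. A (\<bar>f x\<bar> / \<mu>) \<partial>lebesgue_on \<Omega>) \<le> 
      (\<integral>\<^sup>+x. ennreal (1 / m) * indicator (S \<inter> \<Omega>) x \<partial>lebesgue_on \<Omega>)"
  proof (rule nn_integral_mono)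
    fix z assume "z \<in> space (lebesgue_on \<Omega>)"
    hence z: "z \<in> \<Omega>" by simp
    show "A (\<bar>f z\<bar> / \<mu>) \<le> ennreal (1 / m) * indicator (S \<inter> \<Omega>) z"
    proof (cases "z \<in> S")
      case True
      have "\<bar>f z\<bar> / \<mu> \<le> \<kappa> / \<mu>" using bound[of z] \<mu>(1) by (intro divide_right_mono) auto
      hence "\<bar>f z\<bar> / \<mu> < b" using b unfolding \<mu>(2) by linarith
      hence "A (\<bar>f z\<bar> / \<mu>) \<le> ennreal (1 / m)"
        using \<mu>(1) by (intro real_inverse_below[OF A]) (auto simp: b_def)
      thus ?thesis using True z by simp
    next
      case False
      thus ?thesis using supp young_function_zero[OF A] by simp
    qed
  qed
  also have "\<dots> = ennreal (1 / m) * emeasure (lebesgue_on \<Omega>) (S \<inter> \<Omega>)"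
    using \<Omega> S by (intro nn_integral_cmult_indicator) (auto simp: sets_restrict_space)
  also have "emeasure (lebesgue_on \<Omega>) (S \<inter> \<Omega>) = ennreal m"
    using \<Omega> m by (subst emeasure_restrict_space) auto
  also have "ennreal (1 / m) * ennreal m = 1"
    using m by (simp flip: ennreal_mult)
  finally have le: "(\<integral>\<^sup>+x. A (\<bar>f x\<bar> / \<mu>) \<partial>lebesgue_on \<Omega>) \<le> 1" .
  have "f \<in> borel_measurable (lebesgue_on \<Omega>)"
    using f by (intro measurable_restrict_space1 measurable_completion) auto
  moreover have "(\<integral>\<^sup>+x. A (\<bar>f x\<bar> / \<mu>) \<partial>lebesgue_on \<Omega>) < \<infinity>"
    using le by (rule le_less_trans) simp
  ultimately show "f \<in> orlicz_space A \<Omega>" using \<mu> by (auto simp: orlicz_space_def)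
  show "orlicz_norm A \<Omega> f \<le> ennreal (2 * \<kappa> / real_inverse A (1 / m))"
    unfolding orlicz_norm_def using le \<mu> by (intro INF_lower) (auto simp: \<mu>_def b_def)
qed

text \<open>Were \<open>1 / \<mu>\<close> larger than \<open>\<beta>\<close> for an admissible \<open>\<mu>\<close>, the modular would be at least \<open>t * m > 1\<close>
  by the contribution of \<open>S\<close> alone.\<close>

lemma orlicz_norm_ge:
  fixes f :: "real^'n \<Rightarrow> real"
  assumes B: "young_function B" and \<Omega>: "\<Omega> \<in> sets lebesgue" and S: "S \<in> sets lebesgue" "S \<subseteq> \<Omega>"
    and f: "\<And>z. z \<in> S \<Longrightarrow> f z = 1"
    and m: "emeasure lebesgue S = ennreal m" "0 \<le> m" and t: "1 < t * m" "0 \<le> t"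
    and \<beta>: "0 < \<beta>" "ennreal t \<le> B \<beta>"
  shows "ennreal (1 / \<beta>) \<le> orlicz_norm B \<Omega> f"
  unfolding orlicz_norm_def
proof (rule INF_greatest)
  fix \<mu> assume "\<mu> \<in> {\<mu>. 0 < \<mu> \<and> (\<integral>\<^sup>+x. B (\<bar>f x\<bar> / \<mu>) \<partial>lebesgue_on \<Omega>) \<le> 1}"
  hence \<mu>: "0 < \<mu>" and le: "(\<integral>\<^sup>+x. B (\<bar>f x\<bar> / \<mu>) \<partial>lebesgue_on \<Omega>) \<le> 1" by auto
  show "ennreal (1 / \<beta>) \<le> ennreal \<mu>"
  proof (rule ccontr)
    assume "\<not> ennreal (1 / \<beta>) \<le> ennreal \<mu>"
    hence "\<mu> < 1 / \<beta>" using \<mu> by (simp add: ennreal_le_iff)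
    hence "\<beta> \<le> 1 / \<mu>" using \<mu> \<beta> by (simp add: field_simps)
    hence large: "ennreal t \<le> B (1 / \<mu>)"
      using young_function_mono[OF B, of \<beta> "1 / \<mu>"] \<beta> by (auto intro: order_trans)
    have "1 < ennreal (t * m)" using t by simp
    also have "\<dots> = ennreal t * emeasure (lebesgue_on \<Omega>) S"
      using \<Omega> S m t by (subst emeasure_restrict_space) (auto simp: ennreal_mult)
    also have "\<dots> = (\<integral>\<^sup>+x. ennreal t * indicator S x \<partial>lebesgue_on \<Omega>)"
      using \<Omega> S by (intro nn_integral_cmult_indicator[symmetric]) (auto simp: sets_restrict_space)
    also have "\<dots> \<le> (\<integral>\<^sup>+x. B (\<bar>f x\<bar> / \<mu>) \<partial>lebesgue_on \<Omega>)"
      using f large by (intro nn_integral_mono) (auto simp: indicator_def)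
    finally show False using le by simp
  qed
qed

section \<open>The measure density condition\<close>

lemma measure_ball_Int_diff_le:
  fixes x :: "'a::euclidean_space"
  assumes \<Omega>: "\<Omega> \<in> sets lebesgue" and s: "0 \<le> s" "s \<le> r"
  shows "measure lebesgue (ball x s \<inter> \<Omega>) \<le> measure lebesgue (ball x r \<inter> \<Omega>)"
    and "measure lebesgue (ball x r \<inter> \<Omega>) - measure lebesgue (ball x s \<inter> \<Omega>) \<le> 
      unit_ball_vol (real DIM('a)) * (r ^ DIM('a) - s ^ DIM('a))"
proof -
  have sub: "ball x s \<subseteq> ball x r" using s by (simp add: subset_ball)
  have fin: "T \<inter> \<Omega> \<in> lmeasurable" if "T \<in> lmeasurable" for T
    using that \<Omega> by (rule fmeasurable_Int_fmeasurable)
  show "measure lebesgue (ball x s \<inter> \<Omega>) \<le> measure lebesgue (ball x r \<inter> \<Omega>)"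
    using sub \<Omega> by (intro measure_mono_fmeasurable fin) auto
  have "measure lebesgue (ball x r \<inter> \<Omega>) - measure lebesgue (ball x s \<inter> \<Omega>) = 
      measure lebesgue (ball x r \<inter> \<Omega> - ball x s \<inter> \<Omega>)"
    using sub by (intro measurable_measure_Diff[symmetric] fin fmeasurableD[OF fin]) auto
  also have "\<dots> \<le> measure lebesgue (ball x r - ball x s)"
    using \<Omega> by (intro measure_mono_fmeasurable fmeasurable.Diff) (auto intro!: sets.Diff sets.Int)
  also have "\<dots> = measure lebesgue (ball x r) - measure lebesgue (ball x s)"
    using sub by (intro measurable_measure_Diff) auto
  also have "\<dots> = unit_ball_vol (real DIM('a)) * (r ^ DIM('a) - s ^ DIM('a))"
    using s content_ball[of r x] content_ball[of s x] by (simp add: algebra_simps)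
  finally show "measure lebesgue (ball x r \<inter> \<Omega>) - measure lebesgue (ball x s \<inter> \<Omega>) \<le> 
      unit_ball_vol (real DIM('a)) * (r ^ DIM('a) - s ^ DIM('a))" .
qed

lemma continuous_on_measure_ball_Int:
  fixes x :: "'a::euclidean_space"
  assumes "\<Omega> \<in> sets lebesgue"
  shows "continuous_on {0..} (\<lambda>r. measure lebesgue (ball x r \<inter> \<Omega>))"
proof -
  let ?V = "\<lambda>r. measure lebesgue (ball x r \<inter> \<Omega>)"
  let ?w = "\<lambda>r. unit_ball_vol (real DIM('a)) * r ^ DIM('a)"
  have le: "\<bar>?V r - ?V s\<bar> \<le> \<bar>?w r - ?w s\<bar>" if "0 \<le> s" "s \<le> r" for r s
    using measure_ball_Int_diff_le[OF assms that, of x] by (simp add: algebra_simps)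
  have le': "\<bar>?V r - ?V s\<bar> \<le> \<bar>?w r - ?w s\<bar>" if "0 \<le> s" "0 \<le> r" for r s
    using le[of s r] le[of r s] that by (cases "s \<le> r") (auto simp: abs_minus_commute)
  have "continuous_on {0..} ?w" by (intro continuous_intros)
  thus ?thesis unfolding continuous_on_def
  proof (intro ballI)
    fix s :: real assume w: "\<forall>s\<in>{0..}. (?w \<longlongrightarrow> ?w s) (at s within {0..})" and s: "s \<in> {0..}"
    have "((\<lambda>r. \<bar>?w r - ?w s\<bar>) \<longlongrightarrow> 0) (at s within {0..})"
      using w s by (auto intro!: tendsto_rabs_zero simp: LIM_zero_iff)
    hence "((\<lambda>r. ?V r - ?V s) \<longlongrightarrow> 0) (at s within {0..})"
      by (rule Lim_null_comparison[rotated]) (use le' s in \<open>auto simp: eventually_at_filter\<close>)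
    thus "(?V \<longlongrightarrow> ?V s) (at s within {0..})" by (simp add: LIM_zero_iff)
  qed
qed

text \<open>The volume of the intersection depends continuously on the radius and tends to 0 with it.\<close>

lemma halving_radius_exists:
  fixes x :: "'a::euclidean_space"
  assumes \<Omega>: "\<Omega> \<in> sets lebesgue" and r: "0 < r" and pos: "0 < measure lebesgue (ball x r \<inter> \<Omega>)"
  obtains s where "0 < s" "s < r"
    "measure lebesgue (ball x s \<inter> \<Omega>) = measure lebesgue (ball x r \<inter> \<Omega>) / 2"
proof -
  let ?V = "\<lambda>r. measure lebesgue (ball x r \<inter> \<Omega>)"
  have "\<exists>s. 0 \<le> s \<and> s \<le> r \<and> ?V s = ?V r / 2"
    using r by (intro IVT') (auto intro: continuous_on_subset[OF continuous_on_measure_ball_Int[OF \<Omega>]])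
  then obtain s where s: "0 \<le> s" "s \<le> r" "?V s = ?V r / 2" by blast
  moreover have "s \<noteq> 0" "s \<noteq> r" using s pos by auto
  ultimately show thesis using that[of s] by auto
qed

text \<open>The cutoff between the two balls is 1 on a set of volume \<open>m / 2\<close> and supported in a set of
  volume \<open>m\<close>. Its norm in the target space is therefore at least a multiple of
  \<open>1 / sobolev_inv n A (3 / m)\<close>, and its Sobolev norm at most a multiple of
  \<open>1 / ((r - s) * A\<^sup>-\<^sup>1(1 / m))\<close>. The quotient of \<open>sobolev_inv n A\<close> and \<open>A\<^sup>-\<^sup>1\<close> is the power of \<open>m\<close> in the
  conclusion. The argument \<open>3 / m\<close> leaves a strict inequality \<open>m / 2 * (3 / m) > 1\<close>.\<close>

lemma halving_radius_gap_le:
  fixes \<Omega> :: "(real^'n) set" and x :: "real^'n"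
  assumes A: "young_function A" and B: "young_function B" and \<Omega>: "\<Omega> \<in> sets lebesgue"
    and embedding: "\<And>u. u \<in> orlicz_sobolev_space A \<Omega> \<Longrightarrow> 
      orlicz_norm B \<Omega> u \<le> ennreal C\<^sub>1 * orlicz_sobolev_norm A \<Omega> u"
    and C: "0 < C" and C\<^sub>1: "0 < C\<^sub>1"
    and B_ge: "ennreal (3 / m) \<le> B (C * sobolev_inv CARD('n) A (3 / m))"
    and s: "0 \<le> s" "s < r" "r \<le> 1"
    and m: "measure lebesgue (ball x r \<inter> \<Omega>) = m" "0 < m"
    and half: "measure lebesgue (ball x s \<inter> \<Omega>) = m / 2"
  shows "r - s \<le> 3 * C * C\<^sub>1 * (2 + 8 * real CARD('n)) * m powr (1 / real CARD('n))"
proof -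
  define n where "n = CARD('n)"
  define b where "b = real_inverse A (1 / m)"
  define u where "u = cutoff x s r"
  define v where "v i z = cutoff_deriv x s r z (axis i 1)" for i z
  define \<beta> where "\<beta> = C * sobolev_inv n A (3 / m)"
  have b: "0 < b" using real_inverse_pos[OF A] m by (simp add: b_def)
  have emeasure: "emeasure lebesgue (ball x \<rho> \<inter> \<Omega>) = ennreal (measure lebesgue (ball x \<rho> \<inter> \<Omega>))" for \<rho>
    using \<Omega> by (intro emeasure_eq_measure2 fmeasurable_Int_fmeasurable) auto
  have deriv: "(u has_derivative cutoff_deriv x s r z) (at z)" for z
    unfolding u_def using s by (intro cutoff_has_derivative) auto
  have cont: "continuous_on UNIV u"
    using deriv by (meson continuous_at_imp_continuous_on has_derivative_continuous)
  have contv: "continuous_on UNIV (v i)" for i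
    unfolding v_def by (rule continuous_cutoff_deriv)
  have u: "u \<in> orlicz_space A \<Omega>" "orlicz_norm A \<Omega> u \<le> ennreal (2 * 1 / b)"
    unfolding b_def
    by (rule orlicz_norm_bounded_le[OF A \<Omega>, of "ball x r"];
        use s m cutoff_bounds[of x s r] cutoff_outside(1)[of s r _ x] emeasure[of r] cont
        in \<open>auto simp: u_def intro!: borel_measurable_continuous_onI\<close>)+
  have v: "v i \<in> orlicz_space A \<Omega>" "orlicz_norm A \<Omega> (v i) \<le> ennreal (2 * (4 / (r - s)) / b)" for i
    unfolding b_def
    by (rule orlicz_norm_bounded_le[OF A \<Omega>, of "ball x r"];
        use s m cutoff_deriv_bound[of s r "axis i 1" x] cutoff_outside(2)[of s r _ x] emeasure[of r] contv[of i]
        in \<open>auto simp: v_def intro!: borel_measurable_continuous_onI\<close>)+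
  have weak: "weak_partial_deriv \<Omega> i u (v i)" for i
    unfolding v_def using deriv contv[of i, unfolded v_def] by (rule weak_partial_deriv_C1)
  have space: "u \<in> orlicz_sobolev_space A \<Omega>"
    unfolding orlicz_sobolev_space_def using u v weak by blast
  have "1 / (r - s) \<ge> 1" using s by simp
  hence "2 * 1 / b \<le> 2 * (1 / (r - s)) / b"
    using b by (intro divide_right_mono mult_left_mono) auto
  moreover have "(2 + 8 * real n) / ((r - s) * b) = 2 * (1 / (r - s)) / b + real n * (2 * (4 / (r - s)) / b)"
    by (simp add: add_divide_distrib)
  ultimately have sum_le: "2 * 1 / b + real n * (2 * (4 / (r - s)) / b) \<le> (2 + 8 * real n) / ((r - s) * b)"
    by linarith
  have "orlicz_sobolev_norm A \<Omega> u \<le> ennreal (2 * 1 / b) + (\<Sum>i\<in>(UNIV::'n set). ennreal (2 * (4 / (r - s)) / b))"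
    unfolding orlicz_sobolev_norm_def
    using u v weak by (intro add_mono sum_mono) (auto intro: INF_lower2)
  also have "\<dots> = ennreal (2 * 1 / b + real n * (2 * (4 / (r - s)) / b))"
  proof -
    have "0 \<le> 2 * (4 / (r - s)) / b" using b s by simp
    thus ?thesis using b unfolding sum_constant n_def[symmetric]
      by (simp only: ennreal_of_nat_eq_real_of_nat ennreal_plus ennreal_mult of_nat_0_le_iff
          mult_nonneg_nonneg divide_nonneg_pos zero_le_numeral zero_le_one)
  qed
  also have "\<dots> \<le> ennreal ((2 + 8 * real n) / ((r - s) * b))"
    by (rule ennreal_leI[OF sum_le])
  finally have norm_u: "orlicz_sobolev_norm A \<Omega> u \<le> ennreal ((2 + 8 * real n) / ((r - s) * b))" .
  have \<beta>: "0 < \<beta>" using C m sobolev_inv_pos[OF A] by (simp add: \<beta>_def)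
  have "ennreal (1 / \<beta>) \<le> orlicz_norm B \<Omega> u"
  proof (rule orlicz_norm_ge[OF B \<Omega>, of "ball x s \<inter> \<Omega>" _ "m / 2" "3 / m"])
    show "emeasure lebesgue (ball x s \<inter> \<Omega>) = ennreal (m / 2)" by (simp add: emeasure half)
    show "u z = 1" if "z \<in> ball x s \<inter> \<Omega>" for z
      using that s cutoff_inside[of s r z x] by (simp add: u_def)
    show "ennreal (3 / m) \<le> B \<beta>" using B_ge by (simp add: \<beta>_def n_def)
  qed (use \<Omega> m \<beta> in auto)
  also have "\<dots> \<le> ennreal C\<^sub>1 * orlicz_sobolev_norm A \<Omega> u" by (rule embedding[OF space])
  also have "\<dots> \<le> ennreal C\<^sub>1 * ennreal ((2 + 8 * real n) / ((r - s) * b))"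
    by (intro mult_left_mono norm_u) auto
  also have "\<dots> = ennreal (C\<^sub>1 * ((2 + 8 * real n) / ((r - s) * b)))"
    using C\<^sub>1 b s by (intro ennreal_mult[symmetric]) auto
  finally have "1 / \<beta> \<le> C\<^sub>1 * ((2 + 8 * real n) / ((r - s) * b))"
    using C\<^sub>1 b s by (subst (asm) ennreal_le_iff) auto
  hence upper: "1 / \<beta> \<le> C\<^sub>1 * (2 + 8 * real n) / b / (r - s)" by (simp add: mult.commute)
  have \<beta>_le: "\<beta> \<le> C * (3 * b * m powr (1 / real n))"
  proof -
    have "real_inverse A (3 / m) \<le> 3 * b"
      using real_inverse_sublinear[OF A, of "1 / m" 3] m by (simp add: b_def)
    moreover have "(3 / m) powr (- 1 / real n) \<le> (1 / m) powr (- 1 / real n)"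
      using m by (intro powr_mono2') (auto simp: divide_right_mono)
    moreover have "(1 / m) powr (- 1 / real n) = m powr (1 / real n)"
      using m by (simp add: powr_divide powr_minus field_simps)
    ultimately show ?thesis
      unfolding \<beta>_def sobolev_inv_def using C b by (intro mult_left_mono mult_mono) auto
  qed
  have "r - s = 1 / \<beta> * (\<beta> * (r - s))" using \<beta> by simp
  also have "\<dots> \<le> C\<^sub>1 * (2 + 8 * real n) / b / (r - s) * (\<beta> * (r - s))"
    using \<beta> s by (intro mult_right_mono upper) auto
  also have "\<dots> = C\<^sub>1 * (2 + 8 * real n) * \<beta> / b" using s by simp
  also have "\<dots> \<le> C\<^sub>1 * (2 + 8 * real n) * (C * (3 * b * m powr (1 / real n))) / b"
    using C\<^sub>1 b \<beta>_le by (intro divide_right_mono mult_left_mono) auto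
  also have "\<dots> = 3 * C * C\<^sub>1 * (2 + 8 * real n) * m powr (1 / real n)"
    using b by simp
  finally show ?thesis by (simp add: n_def)
qed

text \<open>Halving \<open>f\<close> repeatedly produces radii decreasing to 0, whose gaps are bounded by a geometric
  series of ratio \<open>2 powr - \<alpha>\<close>. To avoid the infinite sum, the induction stops once the radius
  is below a given \<open>d > 0\<close>, which happens at the latest when the values of \<open>f\<close> have dropped
  below \<open>f d\<close>.\<close>

lemma radius_le_of_halving_gaps:
  fixes f :: "real \<Rightarrow> real"
  assumes \<rho>: "0 < \<rho>" and \<alpha>: "0 < \<alpha>" and D: "0 \<le> D"
    and pos: "\<And>r. 0 < r \<Longrightarrow> r \<le> \<rho> \<Longrightarrow> 0 < f r"
    and mono: "\<And>s r. 0 < s \<Longrightarrow> s \<le> r \<Longrightarrow> f s \<le> f r"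
    and halving: "\<And>r. 0 < r \<Longrightarrow> r \<le> \<rho> \<Longrightarrow> \<exists>s. 0 < s \<and> s < r \<and> f s = f r / 2 \<and> r - s \<le> D * f r powr \<alpha>"
  shows "\<rho> \<le> D / (1 - 2 powr - \<alpha>) * f \<rho> powr \<alpha>"
proof -
  define q :: real where "q = 2 powr - \<alpha>"
  define E where "E = D / (1 - q)"
  have "q < 2 powr 0" unfolding q_def using \<alpha> by (intro powr_less_mono) auto
  hence q: "0 < q" "q < 1" by (auto simp: q_def)
  have E: "0 \<le> E" "D + E * q = E" using q D by (auto simp: E_def field_simps)
  have le: "\<rho> \<le> d + E * f \<rho> powr \<alpha>" if d: "0 < d" "d \<le> \<rho>" for d
  proof -
    have "r \<le> d + E * f r powr \<alpha>" if "0 < r" "r \<le> \<rho>" "f r < 2 ^ j * f d" for j r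
      using that
    proof (induction j arbitrary: r)
      case 0
      hence "r < d" using mono[of d r] d by force
      moreover have "0 \<le> E * f r powr \<alpha>" using E by simp
      ultimately show ?case by linarith
    next
      case (Suc j)
      obtain s where s: "0 < s" "s < r" "f s = f r / 2" "r - s \<le> D * f r powr \<alpha>"
        using halving[OF Suc.prems(1,2)] by blast
      have "f s powr \<alpha> = q * f r powr \<alpha>"
        using pos[OF Suc.prems(1,2)] by (simp add: s(3) q_def powr_divide powr_minus field_simps)
      moreover have "s \<le> d + E * f s powr \<alpha>"
        using s Suc.prems by (intro Suc.IH) auto
      ultimately have "r \<le> d + (D + E * q) * f r powr \<alpha>"
        using s(4) by (simp add: algebra_simps)
      thus ?case by (simp only: E(2))
    qed
    moreover obtain j where "f \<rho> / f d < 2 ^ j" using real_arch_pow[of 2] by auto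
    hence "f \<rho> < 2 ^ j * f d" using pos[OF d] by (simp add: pos_divide_less_eq)
    ultimately show ?thesis using \<rho> by blast
  qed
  have "\<rho> \<le> E * f \<rho> powr \<alpha> + e" if "0 < e" for e
    using le[of "min e \<rho>"] that \<rho> by linarith
  hence "\<rho> \<le> E * f \<rho> powr \<alpha>" by (rule field_le_epsilon)
  thus ?thesis by (simp add: E_def q_def)
qed

theorem theorem3p1:
  fixes A A_bar :: "real \<Rightarrow> ennreal" and \<Omega> :: "(real^'n) set"
  assumes "CARD('n) \<ge> 2"
    and "young_function A"
    and "\<exists>s>0. Phi CARD('n) A s < \<infinity>"
    and "local_upper_boyd_index A < ereal (real CARD('n))"
    and "young_function A_bar"
    and "equivalent_near_infinity A_bar (sobolev_conjugate CARD('n) A)"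
    and "open \<Omega>"
    and "\<exists>C>0. \<forall>u \<in> orlicz_sobolev_space A \<Omega>.
           orlicz_norm A_bar \<Omega> u \<le> ennreal C * orlicz_sobolev_norm A \<Omega> u"
  shows "\<exists>c>0. \<forall>x\<in>\<Omega>. \<forall>r. 0 < r \<and> r \<le> 1 \<longrightarrow>
           measure lebesgue (ball x r \<inter> \<Omega>) \<ge> c * r ^ CARD('n)"
proof -
  define n where "n = CARD('n)"
  have n: "2 \<le> n" using assms(1) by (simp add: n_def)
  have dom: "dominates_near_infinity A_bar (sobolev_conjugate n A)"
    using assms(6) by (simp add: equivalent_near_infinity_def n_def)
  have \<Omega>: "\<Omega> \<in> sets lebesgue" using assms(7) by simp
  obtain C t1 where C: "0 < C" and t1: "0 < t1"
    and A_bar_ge: "\<And>t. t1 \<le> t \<Longrightarrow> ennreal t \<le> A_bar (C * sobolev_inv n A t)"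
    by (rule sobolev_conjugate_inverse_bound[OF assms(2) n _ _ dom])
       (use assms(3,4) in \<open>auto simp: n_def\<close>)
  obtain C\<^sub>1 where C\<^sub>1: "0 < C\<^sub>1" and embedding: "\<And>u. u \<in> orlicz_sobolev_space A \<Omega> \<Longrightarrow> 
      orlicz_norm A_bar \<Omega> u \<le> ennreal C\<^sub>1 * orlicz_sobolev_norm A \<Omega> u"
    using assms(8) by blast
  define D where "D = 3 * C * C\<^sub>1 * (2 + 8 * real n)"
  define E where "E = D / (1 - 2 powr - (1 / real n))"
  have D: "0 < D" using C C\<^sub>1 by (simp add: D_def add_pos_nonneg)
  have "(2::real) powr - (1 / real n) < 2 powr 0" using n by (intro powr_less_mono) auto
  hence E: "0 < E" using D by (simp add: E_def)
  define V where "V x r = measure lebesgue (ball x r \<inter> \<Omega>)" for x r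
  have V_mono: "V x s \<le> V x r" if "0 < s" "s \<le> r" for x s r
    unfolding V_def using that by (intro measure_ball_Int_diff_le(1)[OF \<Omega>]) auto
  have V_pos: "0 < V x r" if "x \<in> \<Omega>" "0 < r" for x r
  proof -
    have fin: "ball x r \<inter> \<Omega> \<in> lmeasurable" using \<Omega> by (intro fmeasurable_Int_fmeasurable) auto
    have "open (ball x r \<inter> \<Omega>)" "x \<in> ball x r \<inter> \<Omega>" using that assms(7) by auto
    hence "\<not> negligible (ball x r \<inter> \<Omega>)" using open_not_negligible by blast
    hence "V x r \<noteq> 0" using fin by (auto simp: V_def negligible_iff_measure)
    thus ?thesis by (simp add: V_def order_less_le)
  qed
  \<comment> \<open>The gap estimate is available for volumes below \<open>1 / t1\<close>; larger volumes satisfy the claim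
    with the constant \<open>1 / t1\<close>, because \<open>r \<le> 1\<close>.\<close>
  show ?thesis
  proof (intro exI[of _ "min (1 / t1) (1 / E ^ n)"] conjI ballI allI impI)
    show "0 < min (1 / t1) (1 / E ^ n)" using t1 E by simp
    fix x :: "real^'n" and r :: real assume x: "x \<in> \<Omega>" and "0 < r \<and> r \<le> 1"
    hence r: "0 < r" "r \<le> 1" by auto
    have "min (1 / t1) (1 / E ^ n) * r ^ n \<le> V x r"
    proof (cases "1 / t1 \<le> V x r")
      case True
      have "min (1 / t1) (1 / E ^ n) * r ^ n \<le> 1 / t1 * 1"
        using r t1 E by (intro mult_mono power_le_one) auto
      thus ?thesis using True by simp
    next
      case False
      have "r \<le> D / (1 - 2 powr - (1 / real n)) * V x r powr (1 / real n)"
      proof (rule radius_le_of_halving_gaps)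
        fix \<rho> assume \<rho>: "0 < \<rho>" "\<rho> \<le> r"
        have small: "V x \<rho> < 1 / t1" using V_mono[OF \<rho>, of x] False by simp
        obtain s where s: "0 < s" "s < \<rho>" "V x s = V x \<rho> / 2"
          using halving_radius_exists[OF \<Omega> \<rho>(1), of x] V_pos[OF x \<rho>(1)] unfolding V_def by blast
        have "t1 \<le> 3 / V x \<rho>"
          using small t1 V_pos[OF x \<rho>(1)] by (simp add: field_simps)
        hence "\<rho> - s \<le> D * V x \<rho> powr (1 / real n)"
          unfolding D_def n_def
          by (intro halving_radius_gap_le[OF assms(2,5) \<Omega> embedding C C\<^sub>1 _ _ s(2)])
             (use A_bar_ge s \<rho> r V_pos[OF x \<rho>(1)] in \<open>auto simp: V_def n_def\<close>)
        thus "\<exists>s>0. s < \<rho> \<and> V x s = V x \<rho> / 2 \<and> \<rho> - s \<le> D * V x \<rho> powr (1 / real n)"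
          using s by blast
      qed (use r n D V_pos[OF x] V_mono in auto)
      hence "r \<le> E * V x r powr (1 / real n)" by (simp add: E_def)
      hence "r ^ n \<le> (E * V x r powr (1 / real n)) ^ n"
        using r by (intro power_mono) auto
      also have "\<dots> = E ^ n * V x r"
        using V_pos[OF x r(1)] n by (simp add: power_mult_distrib powr_power)
      finally have "1 / E ^ n * r ^ n \<le> V x r" using E by (simp add: field_simps)
      moreover have "min (1 / t1) (1 / E ^ n) * r ^ n \<le> 1 / E ^ n * r ^ n"
        using r by (intro mult_right_mono) auto
      ultimately show ?thesis by linarith
    qed
    thus "min (1 / t1) (1 / E ^ n) * r ^ CARD('n) \<le> measure lebesgue (ball x r \<inter> \<Omega>)"
      by (simp add: V_def n_def)
  qed
qed

end
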